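(* Let $\gamma\subset\mathbb R^2$ be a curve of class $C^\infty$ which is locally homogeneous under affine transformations. Then $\gamma$ is real-analytic.
   Context: A curve of class $C^\infty$ is an (embedded, locally closed) $1$-dimensional $C^\infty$ submanifold of $\mathbb R^2$; it is real-analytic if it is a real-analytic submanifold. $\gamma$ is locally homogeneous under affine transformations if for any $p,q\in\gamma$ there exist a neighborhood $U$ of $p$ in $\mathbb R^2$ and an invertible affine map $\psi$ of $\mathbb R^2$ (i.e. $\psi(x)=q+A(x-p)$ with $A\in GL(2,\mathbb R)$) such that $\psi(p)=q$ and $\psi(U\cap\gamma)=\gamma\cap\psi(U)$. *)

theory Defs
  imports "HOL-Analysis.Analysis"
begin

definition smooth_map_on :: "real set \<Rightarrow> (real \<Rightarrow> 'a::real_normed_vector) \<Rightarrow> bool" where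
  "smooth_map_on V c \<longleftrightarrow>
     (\<forall>n::nat. ((\<lambda>f t. vector_derivative f (at t)) ^^ n) c differentiable_on V)"

definition real_analytic_map_on :: "real set \<Rightarrow> (real \<Rightarrow> 'a::real_normed_vector) \<Rightarrow> bool" where
  "real_analytic_map_on V c \<longleftrightarrow>
     (\<forall>s\<in>V. \<exists>a r. r > 0 \<and>
        (\<forall>t. \<bar>t - s\<bar> < r \<longrightarrow> (\<lambda>n. (t - s) ^ n *\<^sub>R a n) sums c t))"

(* Embedded one-dimensional submanifolds of the plane, given by coordinate patches: every point
   of G has a relatively open neighbourhood in G that is the homeomorphic image (for the subspace
   topology) of an open subset of the line under an immersion in the regularity class R.
   Such a set is automatically locally closed. *)
definition embedded_curve ::
    "(real set \<Rightarrow> (real \<Rightarrow> real^2) \<Rightarrow> bool) \<Rightarrow> (real^2) set \<Rightarrow> bool" where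
  "embedded_curve R G \<longleftrightarrow>
     (\<forall>p\<in>G. \<exists>U V c d. open U \<and> p \<in> U \<and> open V \<and>
        homeomorphism V (G \<inter> U) c d \<and>
        R V c \<and> (\<forall>t\<in>V. vector_derivative c (at t) \<noteq> 0))"

definition smooth_curve :: "(real^2) set \<Rightarrow> bool" where
  "smooth_curve = embedded_curve smooth_map_on"

definition real_analytic_curve :: "(real^2) set \<Rightarrow> bool" where
  "real_analytic_curve = embedded_curve real_analytic_map_on"

definition locally_affine_homogeneous :: "(real^2) set \<Rightarrow> bool" where
  "locally_affine_homogeneous G \<longleftrightarrow>
     (\<forall>p\<in>G. \<forall>q\<in>G. \<exists>U (A :: real^2^2) \<psi>. open U \<and> p \<in> U \<and> invertible A \<and>
        \<psi> = (\<lambda>x. q + A *v (x - p)) \<and> \<psi> ` (U \<inter> G) = G \<inter> \<psi> ` U)"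

end

theory Submission
  imports Defs
begin

text \<open>
  Homogeneity is used only between points of one chart \<open>c\<close>: it gives local transition maps
  \<open>h\<close> with \<open>c \<circ> h\<close> affinely equivalent to \<open>c\<close>. If the curve has an inflection point, then
  every point of the chart is one and the chart is a line segment. Otherwise parametrize by
  affine arc length, so that the velocity \<open>T\<close> satisfies \<open>cross2 T T' = \<plusminus>1\<close> and
  \<open>T'' = \<kappa> T\<close>. Then every transition map has constant derivative \<open>l\<close>, and
  \<open>\<kappa> = l\<^sup>2 (\<kappa> \<circ> h)\<close>, \<open>\<kappa>' = l\<^sup>3 (\<kappa>' \<circ> h)\<close>. Hence \<open>\<kappa>\<close> vanishes identically or
  \<open>\<kappa>'\<^sup>2 / \<kappa>\<^sup>3\<close> is constant, which makes \<open>\<bar>\<kappa>\<bar>\<close> the inverse square of an affine function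
  \<open>a s + b\<close>. So \<open>T\<close> solves the Euler equation \<open>(a s + b)\<^sup>2 T'' = k T\<close>, whose solutions are analytic.
\<close>

section \<open>Smooth maps of one variable\<close>

text \<open>The derivative is an existential witness instead of a \<open>vector_derivative\<close>
  term, so the closure rules below follow by induction from the usual derivative rules. Smoothness
  on an open set amounts to \<open>C_on n\<close> for every \<open>n\<close>.\<close>

primrec C_on :: "nat \<Rightarrow> real set \<Rightarrow> (real \<Rightarrow> 'a::real_normed_vector) \<Rightarrow> bool" where
  "C_on 0 S f \<longleftrightarrow> True"
| "C_on (Suc n) S f \<longleftrightarrow>
     (\<exists>f'. (\<forall>t\<in>S. (f has_vector_derivative f' t) (at t)) \<and> C_on n S f')"

lemma C_on_SucI:
  "(\<And>t. t \<in> S \<Longrightarrow> (f has_vector_derivative f' t) (at t)) \<Longrightarrow> C_on n S f' \<Longrightarrow> C_on (Suc n) S f"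
  by auto

lemma C_on_cong:
  assumes "open S" "\<And>t. t \<in> S \<Longrightarrow> f t = g t" "C_on n S f"
  shows "C_on n S g"
proof (cases n)
  case (Suc m)
  then obtain f' where f': "\<forall>t\<in>S. (f has_vector_derivative f' t) (at t)" "C_on m S f'"
    using assms(3) by auto
  have "(g has_vector_derivative f' t) (at t)" if "t \<in> S" for t
    using has_vector_derivative_transform_within_open[OF _ \<open>open S\<close> that, of f "f' t" g]
      f'(1) that assms(2) by blast
  then show ?thesis using f' Suc by auto
qed auto

lemma C_on_subset: "C_on n S f \<Longrightarrow> S' \<subseteq> S \<Longrightarrow> C_on n S' f"
  by (induction n arbitrary: f) (simp, metis C_on.simps(2) subsetD)

lemma C_on_Suc_imp: "C_on (Suc n) S f \<Longrightarrow> C_on n S f"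
  by (induction n arbitrary: f) (simp, metis C_on.simps(2))

lemma C_on_add: "C_on n S f \<Longrightarrow> C_on n S g \<Longrightarrow> C_on n S (\<lambda>t. f t + g t)"
proof (induction n arbitrary: f g)
  case (Suc n)
  then obtain f' g' where "\<forall>t\<in>S. (f has_vector_derivative f' t) (at t)" "C_on n S f'"
    "\<forall>t\<in>S. (g has_vector_derivative g' t) (at t)" "C_on n S g'" by auto
  then show ?case
    using Suc.IH[of f' g'] by (auto intro!: exI[of _ "\<lambda>t. f' t + g' t"] has_vector_derivative_add)
qed auto

text \<open>Leibniz rule inside an induction over all pairs \<open>f\<close>, \<open>g\<close>: each
  term pairs one function with the derivative of the other, and \<open>C_on_Suc_imp\<close> lowers
  the undifferentiated factor to order \<open>n\<close>.\<close>

lemma C_on_bilinear: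
  assumes "bounded_bilinear B"
  shows "C_on n S f \<Longrightarrow> C_on n S g \<Longrightarrow> C_on n S (\<lambda>t. B (f t) (g t))"
proof (induction n arbitrary: f g)
  case (Suc n)
  then obtain f' g' where d: "\<forall>t\<in>S. (f has_vector_derivative f' t) (at t)" "C_on n S f'"
    "\<forall>t\<in>S. (g has_vector_derivative g' t) (at t)" "C_on n S g'" by auto
  have "C_on n S (\<lambda>t. B (f t) (g' t) + B (f' t) (g t))"
    by (intro C_on_add Suc.IH d C_on_Suc_imp[OF Suc.prems(1)] C_on_Suc_imp[OF Suc.prems(2)])
  then show ?case
    using d bounded_bilinear.has_vector_derivative[OF assms]
    by (auto intro!: exI[of _ "\<lambda>t. B (f t) (g' t) + B (f' t) (g t)"])
qed auto

lemmas C_on_mult = C_on_bilinear[OF bounded_bilinear_mult]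
lemmas C_on_scaleR = C_on_bilinear[OF bounded_bilinear_scaleR]

lemma C_on_const: "C_on n S (\<lambda>_. k)"
  by (induction n arbitrary: k) (auto intro!: exI[of _ "\<lambda>_. 0"])

text \<open>The derivative of \<open>1 / f\<close> contains \<open>1 / f\<close> itself, but only to
  order \<open>n\<close>, which the induction hypothesis supplies.\<close>

lemma C_on_inverse:
  fixes f :: "real \<Rightarrow> real"
  assumes "\<And>t. t \<in> S \<Longrightarrow> f t \<noteq> 0"
  shows "C_on n S f \<Longrightarrow> C_on n S (\<lambda>t. inverse (f t))"
proof (induction n)
  case (Suc n)
  then obtain f' where d: "\<forall>t\<in>S. (f has_vector_derivative f' t) (at t)" "C_on n S f'" by auto
  have i: "C_on n S (\<lambda>t. inverse (f t))"
    using Suc C_on_Suc_imp by blast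
  have "C_on n S (\<lambda>t. (-1) * (inverse (f t) * f' t * inverse (f t)))"
    by (intro C_on_mult C_on_const d i)
  moreover have "((\<lambda>t. inverse (f t)) has_vector_derivative
      (-1) * (inverse (f t) * f' t * inverse (f t))) (at t)" if "t \<in> S" for t
    using DERIV_inverse'[of f "f' t" t UNIV] d that assms
    by (auto simp: has_real_derivative_iff_has_vector_derivative)
  ultimately show ?case by (intro C_on_SucI)
qed auto

lemma C_on_powr:
  fixes f :: "real \<Rightarrow> real"
  assumes "\<And>t. t \<in> S \<Longrightarrow> f t > 0"
  shows "C_on n S f \<Longrightarrow> C_on n S (\<lambda>t. f t powr a)"
proof (induction n)
  case (Suc n)
  then obtain f' where d: "\<forall>t\<in>S. (f has_vector_derivative f' t) (at t)" "C_on n S f'" by auto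
  have i: "C_on n S (\<lambda>t. f t powr a)" "C_on n S f"
    using Suc C_on_Suc_imp by blast+
  \<comment> \<open>The derivative is written with \<open>f t powr a / f t\<close> and not with
    exponent \<open>a - 1\<close>, so that the induction hypothesis for the fixed exponent
    \<open>a\<close> applies.\<close>
  have "C_on n S (\<lambda>t. a * (f t powr a * (f' t * inverse (f t))))"
    by (intro C_on_mult C_on_const C_on_inverse d i) (use assms in force)
  moreover have "((\<lambda>t. f t powr a) has_vector_derivative
      a * (f t powr a * (f' t * inverse (f t)))) (at t)" if "t \<in> S" for t
  proof -
    have "(f has_real_derivative f' t) (at t)" "f t > 0"
      using d that assms by (auto simp: has_real_derivative_iff_has_vector_derivative)
    then have "((\<lambda>t. f t powr a) has_real_derivative
      a * (f t powr a * (f' t * inverse (f t)))) (at t)"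
      by (auto intro!: derivative_eq_intros simp: powr_diff field_simps)
    then show ?thesis by (simp add: has_real_derivative_iff_has_vector_derivative)
  qed
  ultimately show ?case by (intro C_on_SucI)
qed auto

section \<open>Iterated derivatives and their agreement with \<open>C_on\<close>\<close>

definition vderiv :: "(real \<Rightarrow> 'a::real_normed_vector) \<Rightarrow> real \<Rightarrow> 'a" where
  "vderiv f t = vector_derivative f (at t)"

lemma smooth_map_on_unfold:
  "smooth_map_on V f \<longleftrightarrow> f differentiable_on V \<and> smooth_map_on V (vderiv f)"
proof -
  have "((\<lambda>f t. vector_derivative f (at t)) ^^ Suc n) f
      = ((\<lambda>f t. vector_derivative f (at t)) ^^ n) (vderiv f)" for n
    by (simp add: funpow_Suc_right vderiv_def[abs_def] del: funpow.simps)
  then show ?thesis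
    unfolding smooth_map_on_def by (metis funpow_0 not0_implies_Suc)
qed

lemma smooth_map_onD:
  assumes "smooth_map_on V f" "open V"
  shows "smooth_map_on V (vderiv f)"
    and "t \<in> V \<Longrightarrow> (f has_vector_derivative vderiv f t) (at t)"
proof -
  show "smooth_map_on V (vderiv f)"
    using assms smooth_map_on_unfold by blast
  have "f differentiable_on V" using assms smooth_map_on_unfold by blast
  then show "t \<in> V \<Longrightarrow> (f has_vector_derivative vderiv f t) (at t)"
    unfolding vderiv_def
    by (metis \<open>open V\<close> differentiable_on_eq_differentiable_at vector_derivative_works)
qed

text \<open>A witness in \<open>C_on\<close> is unique at each point of \<open>V\<close>, hence
  agrees there with \<open>vderiv f\<close>; openness of \<open>V\<close> lets it be exchanged for
  \<open>vderiv f\<close> at all higher orders.\<close>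

lemma smooth_map_on_iff_C_on:
  assumes "open V"
  shows "smooth_map_on V f \<longleftrightarrow> (\<forall>n. C_on n V f)"
proof
  assume "smooth_map_on V f"
  then have "C_on n V f" for n
  proof (induction n arbitrary: f)
    case (Suc n)
    then show ?case using smooth_map_onD[OF Suc.prems assms] by auto
  qed auto
  then show "\<forall>n. C_on n V f" by blast
next
  assume C: "\<forall>n. C_on n V f"
  have "((\<lambda>f t. vector_derivative f (at t)) ^^ n) f differentiable_on V" for n
    using C
  proof (induction n arbitrary: f)
    case 0
    then have "C_on (Suc 0) V f" by blast
    then have "f differentiable_on V"
      unfolding C_on.simps differentiable_on_def
      using differentiableI_vector differentiable_at_withinI by blast
    then show ?case by simp
  next
    case (Suc n)
    have "C_on m V (vderiv f)" for m
    proof -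
      obtain f' where f': "\<forall>t\<in>V. (f has_vector_derivative f' t) (at t)" "C_on m V f'"
        using Suc.prems C_on.simps(2) by blast
      then show ?thesis
        unfolding vderiv_def
        by (intro C_on_cong[OF assms _ f'(2)]) (metis vector_derivative_at)
    qed
    then have "((\<lambda>f t. vector_derivative f (at t)) ^^ n) (vderiv f) differentiable_on V"
      by (intro Suc.IH) blast
    then show ?case by (simp add: funpow_Suc_right vderiv_def[abs_def] del: funpow.simps)
  qed
  then show "smooth_map_on V f" by (simp add: smooth_map_on_def)
qed

section \<open>Parametrizations and transition maps\<close>

text \<open>If \<open>g\<close> solves \<open>g' = r(g)\<close>, the derivative of
  \<open>F(g)\<close> is \<open>(r F')(g)\<close>, again a function of \<open>g\<close>, so the
  induction runs over \<open>F\<close> alone. Inverse functions solve such an equation, which is how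
  smoothness survives a change of parameter.\<close>

lemma C_on_compose_autonomous:
  fixes g :: "real \<Rightarrow> real"
  assumes "\<And>s. s \<in> W \<Longrightarrow> g s \<in> S"
    and "\<And>s. s \<in> W \<Longrightarrow> (g has_vector_derivative r (g s)) (at s)"
  shows "C_on n S r \<Longrightarrow> C_on n S F \<Longrightarrow> C_on n W (\<lambda>s. F (g s))"
proof (induction n arbitrary: F)
  case (Suc n)
  then obtain F' where F': "\<forall>t\<in>S. (F has_vector_derivative F' t) (at t)" "C_on n S F'"
    by auto
  have "C_on n W (\<lambda>s. r (g s) *\<^sub>R F' (g s))"
    by (intro Suc.IH C_on_scaleR F' C_on_Suc_imp[OF Suc.prems(1)])
  moreover have "((\<lambda>s. F (g s)) has_vector_derivative r (g s) *\<^sub>R F' (g s)) (at s)"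
    if "s \<in> W" for s
    using vector_diff_chain_at[OF assms(2)[OF that], of F "F' (g s)"] F'(1) assms(1)[OF that]
    by (simp add: o_def)
  ultimately show ?case by (intro C_on_SucI)
qed auto

text \<open>The topological half of a chart in \<open>embedded_curve\<close>. Regularity and nonzero
  velocity are kept apart, since they are re-established after each change of parameter.\<close>

definition local_param :: "'a::metric_space set \<Rightarrow> real set \<Rightarrow> (real \<Rightarrow> 'a) \<Rightarrow> bool" where
  "local_param G V c \<longleftrightarrow> open V \<and> (\<exists>U d. open U \<and> homeomorphism V (G \<inter> U) c d)"

text \<open>A positive derivative makes \<open>f\<close> strictly increasing on the interval
  \<open>I\<close>, hence a homeomorphism onto an open \<open>W\<close>; \<open>g\<close> is its
  inverse. The derivative of \<open>g\<close> is stated as a function of \<open>g\<close> to fit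
  \<open>C_on_compose_autonomous\<close>.\<close>

lemma local_param_reparam:
  fixes f :: "real \<Rightarrow> real"
  assumes "local_param G V c" and I: "I \<subseteq> V" "open I" "connected I"
    and f: "\<And>t. t \<in> I \<Longrightarrow> (f has_real_derivative f' t) (at t)"
    and pos: "\<And>t. t \<in> I \<Longrightarrow> f' t > 0"
  obtains W g where "local_param G W (\<lambda>s. c (g s))" "g ` W = I" "connected W"
    "\<And>s. s \<in> W \<Longrightarrow> (g has_real_derivative inverse (f' (g s))) (at s)"
proof -
  obtain U d where "open U" and hom: "homeomorphism V (G \<inter> U) c d"
    using assms(1) by (auto simp: local_param_def)
  have less: "f x < f y" if "x \<in> I" "y \<in> I" "x < y" for x y
  proof (rule DERIV_pos_imp_increasing[OF \<open>x < y\<close>])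
    fix z assume "x \<le> z" "z \<le> y"
    then have "z \<in> I"
      using \<open>connected I\<close> that by (meson connected_iff_interval)
    then show "\<exists>D. DERIV f z :> D \<and> 0 < D" using f pos by blast
  qed
  then have "inj_on f I"
    by (metis linorder_inj_onI' less_irrefl)
  have cont: "continuous_on I f"
    using f DERIV_isCont continuous_at_imp_continuous_on by blast
  define W where "W = f ` I"
  obtain g where g: "homeomorphism I W f g"
    using invariance_of_domain_homeomorphism[OF I(2) cont _ \<open>inj_on f I\<close>] unfolding W_def by auto
  have "open W"
    unfolding W_def using invariance_of_domain cont I(2) \<open>inj_on f I\<close> by blast
  have "connected W"
    unfolding W_def using connected_continuous_image cont I(3) by blast
  \<comment> \<open>A homeomorphism sends open subsets of \<open>V\<close> to relatively open
    subsets of its image, so the piece over \<open>I\<close> is again cut out of \<open>G\<close> by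
    an open set of the plane.\<close>
  have "openin (top_of_set (G \<inter> U)) (c ` I)"
    using homeomorphism_imp_open_map[OF hom] I by (simp add: open_subset)
  then obtain U' where "open U'" "c ` I = G \<inter> U \<inter> U'"
    by (auto simp: openin_open)
  then have U': "open (U \<inter> U')" "c ` I = G \<inter> (U \<inter> U')"
    using \<open>open U\<close> by auto
  have "homeomorphism I (G \<inter> (U \<inter> U')) c d"
    by (rule homeomorphism_of_subsets[OF hom I(1) order_refl U'(2)])
  then have "homeomorphism W (G \<inter> (U \<inter> U')) (c \<circ> g) (f \<circ> d)"
    using homeomorphism_compose homeomorphism_sym g by blast
  then have lp: "local_param G W (\<lambda>s. c (g s))"
    using U'(1) \<open>open W\<close> by (auto simp: local_param_def o_def)
  have "g ` W = I" using g by (simp add: homeomorphism_def)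
  moreover have "(g has_real_derivative inverse (f' (g s))) (at s)" if "s \<in> W" for s
  proof (rule has_field_derivative_inverse_basic[OF _ _ _ \<open>open W\<close> that])
    have "g s \<in> I" using \<open>g ` W = I\<close> that by blast
    then show "(f has_real_derivative f' (g s)) (at (g s))" "f' (g s) \<noteq> 0"
      using f pos by force+
    show "continuous (at s) g"
      using g \<open>open W\<close> that homeomorphism_cont2 continuous_on_eq_continuous_at by blast
    show "f (g z) = z" if "z \<in> W" for z
      using g that homeomorphism_apply2 by fastforce
  qed
  ultimately show thesis using that lp \<open>connected W\<close> by blast
qed

text \<open>The map \<open>h\<close> is the affine symmetry read in the chart, \<open>d\<close>
  after \<open>\<psi>\<close> after \<open>c\<close>. At this stage it is only continuous.\<close>

lemma transition_map:
  assumes "locally_affine_homogeneous G" "local_param G V c" "s1 \<in> V" "s2 \<in> V"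
  obtains A :: "real^2^2" and e h where "open e" "s1 \<in> e" "e \<subseteq> V" "invertible A"
    "h s1 = s2" "\<And>s. s \<in> e \<Longrightarrow> h s \<in> V" "continuous_on e h"
    "\<And>s. s \<in> e \<Longrightarrow> c (h s) = c s2 + A *v (c s - c s1)"
proof -
  obtain U0 d where "open V" "open U0" and hom: "homeomorphism V (G \<inter> U0) c d"
    using assms(2) by (auto simp: local_param_def)
  have inG: "c s \<in> G" "c s \<in> U0" if "s \<in> V" for s
    using hom that unfolding homeomorphism_def by blast+
  obtain U A \<psi> where "open U" "c s1 \<in> U" "invertible A"
    and \<psi>: "\<psi> = (\<lambda>x. c s2 + A *v (x - c s1))" "\<psi> ` (U \<inter> G) = G \<inter> \<psi> ` U"
    using assms(1) inG assms(3,4) unfolding locally_affine_homogeneous_def by metis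
  have contc: "continuous_on V c" and contd: "continuous_on (G \<inter> U0) d"
    using hom by (auto simp: homeomorphism_def)
  have cont\<psi>: "continuous_on S \<psi>" for S
    unfolding \<psi>
    by (intro continuous_intros linear_continuous_on_compose[OF _ matrix_vector_mul_linear])
  have "open (\<psi> -` U0)"
    using cont\<psi> \<open>open U0\<close> by (simp add: open_vimage)
  \<comment> \<open>On \<open>e\<close> the point \<open>c s\<close> lies in \<open>U\<close>, where
    \<open>\<psi>\<close> preserves the curve, and its image lies in \<open>U0\<close>, where
    \<open>d\<close> inverts the chart.\<close>
  define e where "e = V \<inter> c -` (U \<inter> \<psi> -` U0)"
  have "open e"
    unfolding e_def using \<open>open U\<close> \<open>open (\<psi> -` U0)\<close>
    by (intro continuous_open_preimage[OF contc \<open>open V\<close>] open_Int)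
  have \<psi>s1: "\<psi> (c s1) = c s2" by (simp add: \<psi>)
  have "s1 \<in> e"
    using assms(3,4) \<open>c s1 \<in> U\<close> inG \<psi>s1 by (simp add: e_def)
  have im: "\<psi> (c s) \<in> G \<inter> U0" if "s \<in> e" for s
  proof -
    have "\<psi> (c s) \<in> \<psi> ` (U \<inter> G)" using that inG by (auto simp: e_def)
    then show ?thesis using \<psi>(2) that by (auto simp: e_def)
  qed
  define h where "h = (\<lambda>s. d (\<psi> (c s)))"
  show thesis
  proof
    show "h s1 = s2"
      using hom assms(4) by (simp add: h_def \<psi>s1 homeomorphism_def)
    show "h s \<in> V" if "s \<in> e" for s
      using hom im[OF that] unfolding h_def homeomorphism_def by blast
    show "continuous_on e h"
      unfolding h_def
      by (rule continuous_on_compose2[OF contd], rule continuous_on_compose2[OF cont\<psi>],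
          rule continuous_on_subset[OF contc]) (use im in \<open>auto simp: e_def\<close>)
    show "c (h s) = c s2 + A *v (c s - c s1)" if "s \<in> e" for s
      using hom im[OF that] unfolding h_def homeomorphism_def by (simp add: \<psi>)
  qed (use \<open>open e\<close> \<open>s1 \<in> e\<close> \<open>invertible A\<close> e_def in auto)
qed

text \<open>A converse to the chain rule. By Caratheodory, the difference quotient of
  \<open>h\<close> is that of \<open>f(h)\<close> divided by a slope \<open>g(h y)\<close>, which
  tends to \<open>D \<noteq> 0\<close> as \<open>h\<close> is continuous.\<close>

lemma DERIV_cancel_outer:
  fixes f h :: "real \<Rightarrow> real"
  assumes f: "(f has_real_derivative D) (at (h x))" "D \<noteq> 0"
    and fh: "((\<lambda>y. f (h y)) has_real_derivative E) (at x)" and "isCont h x"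
  shows "(h has_real_derivative E / D) (at x)"
proof -
  obtain g where g: "\<And>z. f z - f (h x) = g z * (z - h x)" "isCont g (h x)" "g (h x) = D"
    using f(1) CARAT_DERIV by blast
  have "isCont (\<lambda>y. g (h y)) x"
    using isCont_o2[OF \<open>isCont h x\<close> g(2)] .
  then have lim: "((\<lambda>y. g (h y)) \<longlongrightarrow> D) (at x)"
    using g(3) by (simp add: isCont_def)
  have "((\<lambda>y. (f (h y) - f (h x)) / (y - x) / g (h y)) \<longlongrightarrow> E / D) (at x)"
    using fh by (intro tendsto_divide lim \<open>D \<noteq> 0\<close>) (simp add: has_field_derivative_iff)
  moreover have "\<forall>\<^sub>F y in at x. (f (h y) - f (h x)) / (y - x) / g (h y) = (h y - h x) / (y - x)"
  proof -
    have "\<forall>\<^sub>F y in at x. g (h y) \<noteq> 0"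
      using tendsto_imp_eventually_ne[OF lim \<open>D \<noteq> 0\<close>] .
    then show ?thesis by eventually_elim (simp add: g(1))
  qed
  ultimately have "((\<lambda>y. (h y - h x) / (y - x)) \<longlongrightarrow> E / D) (at x)"
    using Lim_transform_eventually by fast
  then show ?thesis by (simp add: has_field_derivative_iff)
qed

text \<open>Projection to the tangent direction \<open>T\<close> reduces this to the scalar case:
  the function \<open>c y \<bullet> T\<close> has slope \<open>T \<bullet> T \<noteq> 0\<close> at
  \<open>h x\<close>.\<close>

lemma DERIV_cancel_immersion:
  fixes c :: "real \<Rightarrow> 'a::real_inner" and h :: "real \<Rightarrow> real"
  assumes c: "(c has_vector_derivative T) (at (h x))" "T \<noteq> 0"
    and ch: "((\<lambda>y. c (h y)) has_vector_derivative E) (at x)" and "isCont h x"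
  shows "(h has_real_derivative (E \<bullet> T) / (T \<bullet> T)) (at x)"
proof (rule DERIV_cancel_outer)
  show "((\<lambda>y. c y \<bullet> T) has_real_derivative T \<bullet> T) (at (h x))"
    using bounded_linear.has_vector_derivative[OF bounded_linear_inner_left c(1)]
    by (simp add: has_real_derivative_iff_has_vector_derivative)
  show "((\<lambda>y. c (h y) \<bullet> T) has_real_derivative E \<bullet> T) (at x)"
    using bounded_linear.has_vector_derivative[OF bounded_linear_inner_left ch]
    by (simp add: has_real_derivative_iff_has_vector_derivative)
qed (use assms in auto)

text \<open>The relation \<open>c (h s) = c s2 + A *v (c s - c s1)\<close> is differentiated twice;
  \<open>h\<close> inherits its two derivatives from those of \<open>c\<close>.\<close>

lemma transition_derivatives:
  assumes "locally_affine_homogeneous G" "local_param G V c" "s1 \<in> V" "s2 \<in> V"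
    and c: "\<And>s. s \<in> V \<Longrightarrow> (c has_vector_derivative T s) (at s)"
    and T: "\<And>s. s \<in> V \<Longrightarrow> (T has_vector_derivative T1 s) (at s)"
    and nz: "\<And>s. s \<in> V \<Longrightarrow> T s \<noteq> 0"
  obtains A :: "real^2^2" and e h h1 h2 where "open e" "s1 \<in> e" "e \<subseteq> V" "invertible A"
    "h s1 = s2" "\<And>s. s \<in> e \<Longrightarrow> h s \<in> V"
    "\<And>s. s \<in> e \<Longrightarrow> (h has_real_derivative h1 s) (at s)"
    "\<And>s. s \<in> e \<Longrightarrow> (h1 has_real_derivative h2 s) (at s)"
    "\<And>s. s \<in> e \<Longrightarrow> A *v T s = h1 s *\<^sub>R T (h s)"
    "\<And>s. s \<in> e \<Longrightarrow> h1 s \<noteq> 0"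
    "\<And>s. s \<in> e \<Longrightarrow> A *v T1 s = h2 s *\<^sub>R T (h s) + (h1 s)\<^sup>2 *\<^sub>R T1 (h s)"
proof -
  obtain A :: "real^2^2" and e h where e: "open e" "s1 \<in> e" "e \<subseteq> V" and A: "invertible A"
    and h: "h s1 = s2" "\<And>s. s \<in> e \<Longrightarrow> h s \<in> V" "continuous_on e h"
    and ch: "\<And>s. s \<in> e \<Longrightarrow> c (h s) = c s2 + A *v (c s - c s1)"
    using transition_map[OF assms(1-4)] by metis
  have Alin: "((\<lambda>s. A *v F s) has_vector_derivative A *v F') (at s)"
    if "(F has_vector_derivative F') (at s)" for F F' s
    by (rule bounded_linear.has_vector_derivative[OF matrix_vector_mul_bounded_linear that])
  \<comment> \<open>This is the value given by \<open>DERIV_cancel_immersion\<close>. As a quotient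
    built from \<open>T\<close> and \<open>T(h)\<close> it is differentiable once more, which later
    yields \<open>h2\<close>.\<close>
  define h1 where "h1 = (\<lambda>s. ((A *v T s) \<bullet> T (h s)) / (T (h s) \<bullet> T (h s)))"
  have dch: "((\<lambda>s. c (h s)) has_vector_derivative A *v T s) (at s)" if "s \<in> e" for s
  proof (rule has_vector_derivative_transform_within_open[OF _ e(1) that])
    have "((\<lambda>s. c s - c s1) has_vector_derivative T s) (at s)"
      using c that e by (auto intro!: derivative_eq_intros)
    from Alin[OF this]
    show "((\<lambda>s. c s2 + A *v (c s - c s1)) has_vector_derivative A *v T s) (at s)"
      by (auto intro!: derivative_eq_intros)
  qed (use ch in simp)
  have dh: "(h has_real_derivative h1 s) (at s)" if "s \<in> e" for s
    unfolding h1_def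
    by (rule DERIV_cancel_immersion[OF c nz dch])
       (use that h e in \<open>auto simp: continuous_on_eq_continuous_at\<close>)
  have comp: "((\<lambda>s. F (h s)) has_vector_derivative h1 s *\<^sub>R F') (at s)"
    if "s \<in> e" "(F has_vector_derivative F') (at (h s))" for F F' s
    using vector_diff_chain_at[of h "h1 s" s F F'] dh that
    by (simp add: has_real_derivative_iff_has_vector_derivative o_def)
  have AT: "A *v T s = h1 s *\<^sub>R T (h s)" if "s \<in> e" for s
    by (rule vector_derivative_unique_at[OF dch[OF that] comp[OF that]])
       (use that h c in auto)
  have nz1: "h1 s \<noteq> 0" if "s \<in> e" for s
  proof
    assume "h1 s = 0"
    then have "A *v T s = 0" using AT[OF that] by simp
    moreover obtain B where "B ** A = mat 1"
      using A by (auto simp: invertible_left_inverse)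
    ultimately have "T s = 0"
      by (metis matrix_vector_mul_assoc matrix_vector_mul_lid matrix_vector_mult_0_right)
    then show False using nz that e by auto
  qed
  define h2 where "h2 = (\<lambda>s. vector_derivative h1 (at s))"
  have dh1: "(h1 has_real_derivative h2 s) (at s)" if "s \<in> e" for s
  proof -
    have Th: "((\<lambda>s. T (h s)) has_vector_derivative h1 s *\<^sub>R T1 (h s)) (at s)"
      using comp that h T by blast
    have "(\<lambda>s. T (h s)) differentiable at s" "(\<lambda>s. A *v T s) differentiable at s"
      using Th Alin[OF T] that e by (auto intro: differentiableI_vector)
    moreover have "T (h s) \<noteq> 0" using nz h that by blast
    ultimately have "h1 differentiable at s"
      unfolding h1_def by (intro differentiable_divide differentiable_inner) auto
    then show ?thesis
      unfolding h2_def
      by (simp add: has_real_derivative_iff_has_vector_derivative vector_derivative_works)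
  qed
  have AT1: "A *v T1 s = h2 s *\<^sub>R T (h s) + (h1 s)\<^sup>2 *\<^sub>R T1 (h s)" if "s \<in> e" for s
  proof -
    have "((\<lambda>s. h1 s *\<^sub>R T (h s)) has_vector_derivative
        h1 s *\<^sub>R (h1 s *\<^sub>R T1 (h s)) + h2 s *\<^sub>R T (h s)) (at s)"
      by (rule has_vector_derivative_scaleR[OF dh1[OF that] comp[OF that T]]) (use h that in auto)
    then have "((\<lambda>s. A *v T s) has_vector_derivative
        h1 s *\<^sub>R (h1 s *\<^sub>R T1 (h s)) + h2 s *\<^sub>R T (h s)) (at s)"
      by (rule has_vector_derivative_transform_within_open[OF _ e(1) that]) (simp add: AT)
    then have "A *v T1 s = h1 s *\<^sub>R (h1 s *\<^sub>R T1 (h s)) + h2 s *\<^sub>R T (h s)"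
      using vector_derivative_unique_at Alin T e that by blast
    then show ?thesis by (simp add: power2_eq_square)
  qed
  show thesis by (rule that[OF e A h(1,2) dh dh1 AT nz1 AT1])
qed

section \<open>Analyticity of solutions of the Euler equation\<close>

text \<open>The factorial in the bound cancels the one in the Lagrange remainder, leaving a
  remainder of at most \<open>C * (R * \<bar>t - s\<bar>) ^ n\<close>, which tends to 0.\<close>

lemma power_series_of_derivative_bounds:
  fixes Z :: "nat \<Rightarrow> real \<Rightarrow> real"
  assumes der: "\<And>n t. \<bar>t - s\<bar> < r \<Longrightarrow> (Z n has_real_derivative Z (Suc n) t) (at t)"
    and bound: "\<And>n t. \<bar>t - s\<bar> < r \<Longrightarrow> \<bar>Z n t\<bar> \<le> C * R ^ n * fact n"
    and t: "\<bar>t - s\<bar> < r" "R * \<bar>t - s\<bar> < 1" and "R > 0"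
  shows "(\<lambda>n. (t - s) ^ n * (Z n s / fact n)) sums Z 0 t"
proof (cases "t = s")
  case True
  \<comment> \<open>The Taylor formula needs two distinct points; at the centre only the term
    \<open>n = 0\<close> survives, because \<open>0 ^ 0 = 1\<close>.\<close>
  have "(\<lambda>n. (t - s) ^ n * (Z n s / fact n)) = (\<lambda>n. if n = 0 then Z 0 t else 0)"
    using True by (auto simp: fun_eq_iff)
  then show ?thesis using sums_single[of 0 "\<lambda>_. Z 0 t"] by simp
next
  case False
  have C: "C \<ge> 0" using bound[of t 0] t by simp
  have remainder: "\<bar>Z 0 t - (\<Sum>m<n. (t - s) ^ m * (Z m s / fact m))\<bar> \<le> C * (R * \<bar>t - s\<bar>) ^ n"
    if "n > 0" for n
  proof -
    have "\<exists>u. (if t < s then t < u \<and> u < s else s < u \<and> u < t) \<and>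
        Z 0 t = (\<Sum>m<n. Z m s / fact m * (t - s) ^ m) + Z n u / fact n * (t - s) ^ n"
      by (rule Taylor[OF that refl, of "min s t" "max s t"]) (use der t False in auto)
    then obtain u where u: "if t < s then t < u \<and> u < s else s < u \<and> u < t"
      and eq: "Z 0 t = (\<Sum>m<n. Z m s / fact m * (t - s) ^ m) + Z n u / fact n * (t - s) ^ n"
      by blast
    have "\<bar>u - s\<bar> < r" using u t by (auto split: if_splits)
    have "\<bar>Z 0 t - (\<Sum>m<n. (t - s) ^ m * (Z m s / fact m))\<bar> = \<bar>Z n u\<bar> / fact n * \<bar>t - s\<bar> ^ n"
      by (subst eq) (simp add: mult.commute abs_mult power_abs)
    also have "\<dots> \<le> (C * R ^ n * fact n) / fact n * \<bar>t - s\<bar> ^ n"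
      by (intro mult_right_mono divide_right_mono bound \<open>\<bar>u - s\<bar> < r\<close>) auto
    also have "\<dots> = C * (R * \<bar>t - s\<bar>) ^ n" by (simp add: power_mult_distrib)
    finally show ?thesis .
  qed
  have "(\<lambda>n. C * (R * \<bar>t - s\<bar>) ^ n) \<longlonglongrightarrow> 0"
    using LIMSEQ_power_zero[of "R * \<bar>t - s\<bar>"] t \<open>R > 0\<close> by (intro tendsto_mult_right_zero) auto
  then have "(\<lambda>n. Z 0 t - (\<Sum>m<n. (t - s) ^ m * (Z m s / fact m))) \<longlonglongrightarrow> 0"
    by (rule Lim_null_comparison[rotated])
       (use remainder in \<open>auto intro!: eventually_sequentiallyI[of 1]\<close>)
  then have "(\<lambda>n. Z 0 t - (Z 0 t - (\<Sum>m<n. (t - s) ^ m * (Z m s / fact m)))) \<longlonglongrightarrow> Z 0 t - 0"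
    by (intro tendsto_diff tendsto_const)
  then show ?thesis by (simp add: sums_def)
qed

lemma real_analytic_map_on_componentwise:
  fixes c :: "real \<Rightarrow> real ^ 'n"
  assumes "\<And>i. real_analytic_map_on V (\<lambda>t. c t $ i)"
  shows "real_analytic_map_on V c"
  unfolding real_analytic_map_on_def
proof
  fix s assume "s \<in> V"
  then have "\<forall>i. \<exists>a r. r > 0 \<and> (\<forall>t. \<bar>t - s\<bar> < r \<longrightarrow> (\<lambda>n. (t - s) ^ n * a n) sums (c t $ i))"
    using assms by (auto simp: real_analytic_map_on_def)
  then obtain a r where ar: "\<And>i. r i > (0::real)"
    "\<And>i t. \<bar>t - s\<bar> < r i \<Longrightarrow> (\<lambda>n. (t - s) ^ n * a i n) sums (c t $ i)"
    by metis
  \<comment> \<open>There are finitely many coordinates, so the least of their radii is still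
    positive.\<close>
  define \<rho> where "\<rho> = Min (range r)"
  have "(\<lambda>n. (t - s) ^ n *\<^sub>R (\<chi> i. a i n)) sums c t" if "\<bar>t - s\<bar> < \<rho>" for t
    unfolding sums_def
  proof (rule vec_tendstoI)
    fix i
    have "\<bar>t - s\<bar> < r i" using that by (simp add: \<rho>_def)
    then show "((\<lambda>n. (\<Sum>m<n. (t - s) ^ m *\<^sub>R (\<chi> i. a i m)) $ i) \<longlongrightarrow> c t $ i) sequentially"
      using ar(2)[of t i] by (simp add: sums_def)
  qed
  moreover have "\<rho> > 0" using ar(1) by (simp add: \<rho>_def)
  ultimately show "\<exists>a r. r > 0 \<and> (\<forall>t. \<bar>t - s\<bar> < r \<longrightarrow> (\<lambda>n. (t - s) ^ n *\<^sub>R a n) sums c t)"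
    by (intro exI[of _ "\<lambda>n. \<chi> i. a i n"] exI[of _ \<rho>] conjI allI impI)
qed

text \<open>The recursion arises by differentiating \<open>(a * t + b)\<^sup>2 * y'' = k * y\<close> \<open>n\<close> times.\<close>

fun euler_deriv :: "real \<Rightarrow> real \<Rightarrow> real \<Rightarrow> (real \<Rightarrow> real) \<Rightarrow> (real \<Rightarrow> real) \<Rightarrow> nat \<Rightarrow> real \<Rightarrow> real" where
  "euler_deriv k a b y y1 0 t = y t"
| "euler_deriv k a b y y1 (Suc 0) t = y1 t"
| "euler_deriv k a b y y1 (Suc (Suc n)) t =
     (k - real n * (real n - 1) * a\<^sup>2) / (a * t + b)\<^sup>2 * euler_deriv k a b y y1 n t
     - 2 * real n * a / (a * t + b) * euler_deriv k a b y y1 (Suc n) t"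

text \<open>Two-step induction: the right side of the recursion for order \<open>n + 2\<close> is
  differentiated termwise, and the outcome is recognised as the recursion for order
  \<open>n + 3\<close>.\<close>

lemma has_derivative_euler_deriv:
  assumes "(y has_real_derivative y1 t) (at t)" "a * t + b \<noteq> 0"
    and "(y1 has_real_derivative k / (a * t + b)\<^sup>2 * y t) (at t)"
  shows "(euler_deriv k a b y y1 n has_real_derivative euler_deriv k a b y y1 (Suc n) t) (at t)"
proof (induction n rule: induct_nat_012)
  case (ge2 n)
  define Y where "Y = euler_deriv k a b y y1"
  define w where "w = (\<lambda>t. a * t + b)"
  define K where "K = k - real n * (real n - 1) * a\<^sup>2"
  have w: "w t \<noteq> 0" using assms by (simp add: w_def)
  have rec: "Y (Suc (Suc j)) t = (k - real j * (real j - 1) * a\<^sup>2) / (w t)\<^sup>2 * Y j t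
     - 2 * real j * a / w t * Y (Suc j) t" for j t
    unfolding Y_def w_def by (rule euler_deriv.simps(3))
  have dw: "(w has_real_derivative a) (at t)"
    unfolding w_def by (auto intro!: derivative_eq_intros)
  have D1: "((\<lambda>t. K / (w t)\<^sup>2) has_real_derivative - (K * (2 * a) / w t ^ 3)) (at t)"
    by (rule DERIV_cong[OF DERIV_divide[OF DERIV_const DERIV_power[OF dw]]])
       (use w in \<open>simp_all add: field_simps power2_eq_square power3_eq_cube\<close>)
  have D2: "((\<lambda>t. 2 * real n * a / w t) has_real_derivative
      - (2 * real n * a\<^sup>2 / (w t)\<^sup>2)) (at t)"
    by (rule DERIV_cong[OF DERIV_divide[OF DERIV_const dw]])
       (use w in \<open>simp_all add: power2_eq_square\<close>)
  have "(Y (Suc (Suc n)) has_real_derivative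
      (- (K * (2 * a) / w t ^ 3) * Y n t + Y (Suc n) t * (K / (w t)\<^sup>2))
      - (- (2 * real n * a\<^sup>2 / (w t)\<^sup>2) * Y (Suc n) t
         + Y (Suc (Suc n)) t * (2 * real n * a / w t))) (at t)"
    by (rule DERIV_cong_ev[THEN iffD2, OF refl _ refl
          DERIV_diff[OF DERIV_mult[OF D1 ge2(1)[folded Y_def]]
            DERIV_mult[OF D2 ge2(2)[folded Y_def]]]])
       (simp add: rec K_def)
  \<comment> \<open>The last summand is \<open>2 * a / w t\<close> times a bracket that vanishes by
    the recursion for \<open>Y (Suc (Suc n))\<close>; adding it removes \<open>Y n\<close>. The
    shift of the coefficient rests on \<open>(n + 1) * n = n * (n - 1) + 2 * n\<close>.\<close>
  also have "(- (K * (2 * a) / w t ^ 3) * Y n t + Y (Suc n) t * (K / (w t)\<^sup>2))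
      - (- (2 * real n * a\<^sup>2 / (w t)\<^sup>2) * Y (Suc n) t
         + Y (Suc (Suc n)) t * (2 * real n * a / w t))
     = (k - real (Suc n) * (real (Suc n) - 1) * a\<^sup>2) / (w t)\<^sup>2 * Y (Suc n) t
      - 2 * real (Suc n) * a / w t * Y (Suc (Suc n)) t
      + 2 * a / w t * (Y (Suc (Suc n)) t - (K / (w t)\<^sup>2 * Y n t
         - 2 * real n * a / w t * Y (Suc n) t))"
  proof -
    have eq: "k - real (Suc n) * (real (Suc n) - 1) * a\<^sup>2 = K - 2 * real n * a\<^sup>2"
      by (simp add: K_def algebra_simps)
    show ?thesis
      unfolding eq divide_inverse power_inverse[symmetric]
      unfolding of_nat_Suc
      by (simp add: algebra_simps power2_eq_square power3_eq_cube)
  qed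
  also have "\<dots> = Y (Suc (Suc (Suc n))) t"
    using rec[of n t] rec[of "Suc n" t] by (simp add: K_def)
  finally show ?case by (simp add: Y_def)
next
  case 0
  have "euler_deriv k a b y y1 0 = y" by (rule ext) simp
  then show ?case using assms(1) by simp
next
  case 1
  have "euler_deriv k a b y y1 (Suc 0) = y1" by (rule ext) simp
  then show ?case using assms(3) by simp
qed

text \<open>\<open>R\<close> is chosen so that the coefficients of the recursion are at most
  \<open>R^2 / 2 * (n + 1) * (n + 2)\<close> and \<open>R / 2 * (n + 2)\<close>. Then each of the
  two terms contributes at most half of \<open>C * R ^ (n + 2) * fact (n + 2)\<close>. The summand 1
  ensures \<open>R \<ge> 1\<close>, hence \<open>R \<le> R^2\<close>.\<close>

lemma euler_deriv_bound:
  fixes m :: real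
  assumes "0 < m" "m \<le> \<bar>a * t + b\<bar>" and C: "\<bar>y t\<bar> \<le> C" "\<bar>y1 t\<bar> \<le> C"
    and R: "R = 1 + 4 * \<bar>a\<bar> / m + 2 * (\<bar>k\<bar> + a\<^sup>2) / m\<^sup>2"
  shows "\<bar>euler_deriv k a b y y1 n t\<bar> \<le> C * R ^ n * fact n"
proof (induction n rule: induct_nat_012)
  case 1
  have "C \<ge> 0" "R \<ge> 1" using C assms(1) unfolding R by auto
  then have "C * 1 \<le> C * R" by (intro mult_left_mono) auto
  then show ?case using C by simp
next
  case (ge2 n)
  define Y where "Y = euler_deriv k a b y y1"
  define w where "w = a * t + b"
  have C0: "C \<ge> 0" and R1: "R \<ge> 1" using C assms(1) unfolding R by auto
  have mw: "0 < m" "m \<le> \<bar>w\<bar>" using assms by (auto simp: w_def)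
  have Ra: "4 * \<bar>a\<bar> / m \<le> R" and Rk: "2 * (\<bar>k\<bar> + a\<^sup>2) / m\<^sup>2 \<le> R"
    using mw unfolding R by auto
  have IH: "\<bar>Y n t\<bar> \<le> C * R ^ n * fact n" "\<bar>Y (Suc n) t\<bar> \<le> C * R ^ Suc n * fact (Suc n)"
    using ge2 by (simp_all add: Y_def)
  have coeff1: "\<bar>(k - real n * (real n - 1) * a\<^sup>2) / w\<^sup>2\<bar> \<le> R\<^sup>2 / 2 * ((real n + 1) * (real n + 2))"
  proof -
    have n1: "\<bar>real n * (real n - 1)\<bar> \<le> (real n + 1) * (real n + 2)"
      unfolding abs_mult by (intro mult_mono) auto
    have n2: "1 \<le> (real n + 1) * (real n + 2)"
      by (simp add: algebra_simps)
    have "\<bar>k - real n * (real n - 1) * a\<^sup>2\<bar> \<le> \<bar>k\<bar> * 1 + \<bar>real n * (real n - 1)\<bar> * a\<^sup>2"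
      using abs_triangle_ineq4[of k "real n * (real n - 1) * a\<^sup>2"] by (simp add: abs_mult)
    also have "\<dots> \<le> \<bar>k\<bar> * ((real n + 1) * (real n + 2)) + ((real n + 1) * (real n + 2)) * a\<^sup>2"
      by (intro add_mono mult_left_mono mult_right_mono n1 n2) auto
    also have "\<dots> = (\<bar>k\<bar> + a\<^sup>2) * ((real n + 1) * (real n + 2))"
      by (simp add: algebra_simps)
    finally have num: "\<bar>k - real n * (real n - 1) * a\<^sup>2\<bar> \<le> (\<bar>k\<bar> + a\<^sup>2) * ((real n + 1) * (real n + 2))" .
    have "m\<^sup>2 \<le> w\<^sup>2"
      using power_mono[OF mw(2), of 2] mw by simp
    have "\<bar>(k - real n * (real n - 1) * a\<^sup>2) / w\<^sup>2\<bar> = \<bar>k - real n * (real n - 1) * a\<^sup>2\<bar> / w\<^sup>2"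
      by simp
    also have "\<dots> \<le> (\<bar>k\<bar> + a\<^sup>2) * ((real n + 1) * (real n + 2)) / m\<^sup>2"
      by (rule frac_le[OF _ num _ \<open>m\<^sup>2 \<le> w\<^sup>2\<close>]) (use mw in auto)
    also have "\<dots> = (2 * (\<bar>k\<bar> + a\<^sup>2) / m\<^sup>2) / 2 * ((real n + 1) * (real n + 2))"
      using mw by (simp add: field_simps)
    also have "\<dots> \<le> R / 2 * ((real n + 1) * (real n + 2))"
      by (intro mult_right_mono divide_right_mono Rk) auto
    also have "\<dots> \<le> R\<^sup>2 / 2 * ((real n + 1) * (real n + 2))"
      using R1 by (intro mult_right_mono divide_right_mono) (auto simp: power2_eq_square)
    finally show ?thesis .
  qed
  have coeff2: "\<bar>2 * real n * a / w\<bar> \<le> R / 2 * (real n + 2)"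
  proof -
    have "\<bar>2 * real n * a / w\<bar> = 2 * real n * \<bar>a\<bar> / \<bar>w\<bar>" by (simp add: abs_mult)
    also have "\<dots> \<le> 2 * real n * \<bar>a\<bar> / m"
      by (rule frac_le) (use mw in auto)
    also have "\<dots> = (4 * \<bar>a\<bar> / m) / 2 * real n" by simp
    also have "\<dots> \<le> R / 2 * (real n + 2)"
      by (intro mult_mono divide_right_mono Ra) (use R1 in auto)
    finally show ?thesis .
  qed
  have "\<bar>Y (Suc (Suc n)) t\<bar> \<le> \<bar>(k - real n * (real n - 1) * a\<^sup>2) / w\<^sup>2\<bar> * \<bar>Y n t\<bar>
      + \<bar>2 * real n * a / w\<bar> * \<bar>Y (Suc n) t\<bar>"
    unfolding abs_mult[symmetric] Y_def w_def by (simp only: euler_deriv.simps abs_triangle_ineq4)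
  also have "\<dots> \<le> R\<^sup>2 / 2 * ((real n + 1) * (real n + 2)) * (C * R ^ n * fact n)
      + R / 2 * (real n + 2) * (C * R ^ Suc n * fact (Suc n))"
    using C0 R1 by (intro add_mono mult_mono coeff1 coeff2 IH) auto
  also have "\<dots> = C * R ^ Suc (Suc n) * fact (Suc (Suc n))"
    by (simp add: field_simps power2_eq_square)
  finally show ?case by (simp add: Y_def)
next
  case 0
  then show ?case using C(1) by simp
qed

text \<open>Here \<open>f\<close> is a primitive of a solution \<open>y\<close> of the Euler
  equation. Compactness of a closed ball makes the constants of \<open>euler_deriv_bound\<close>
  uniform, and the factorial bounds then force the Taylor series to converge to
  \<open>f\<close>.\<close>

lemma real_analytic_map_on_euler_ode:
  assumes "open W" and w: "\<And>s. s \<in> W \<Longrightarrow> a * s + b \<noteq> 0"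
    and f: "\<And>s. s \<in> W \<Longrightarrow> (f has_real_derivative y s) (at s)"
    and y: "\<And>s. s \<in> W \<Longrightarrow> (y has_real_derivative y1 s) (at s)"
    and y1: "\<And>s. s \<in> W \<Longrightarrow> (y1 has_real_derivative k / (a * s + b)\<^sup>2 * y s) (at s)"
  shows "real_analytic_map_on W f"
  unfolding real_analytic_map_on_def
proof
  fix s assume "s \<in> W"
  then obtain r where r: "r > 0" "cball s r \<subseteq> W"
    using \<open>open W\<close> open_contains_cball by blast
  have cont: "continuous_on (cball s r) f" "continuous_on (cball s r) y"
      "continuous_on (cball s r) y1"
    using f y y1 r DERIV_isCont continuous_at_imp_continuous_on by (meson subset_iff)+
  have "bounded (f ` cball s r)" "bounded (y ` cball s r)" "bounded (y1 ` cball s r)"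
    using cont compact_continuous_image compact_imp_bounded compact_cball by blast+
  then obtain C1 C2 C3 where C1: "\<forall>t\<in>cball s r. \<bar>f t\<bar> \<le> C1"
    "\<forall>t\<in>cball s r. \<bar>y t\<bar> \<le> C2" "\<forall>t\<in>cball s r. \<bar>y1 t\<bar> \<le> C3"
    unfolding bounded_iff by auto
  define C where "C = max C1 (max C2 C3)"
  have C: "\<bar>f t\<bar> \<le> C" "\<bar>y t\<bar> \<le> C" "\<bar>y1 t\<bar> \<le> C" if "t \<in> cball s r" for t
    using that C1 unfolding C_def by (auto simp: le_max_iff_disj)
  have "continuous_on (cball s r) (\<lambda>t. \<bar>a * t + b\<bar>)" by (intro continuous_intros)
  \<comment> \<open>The minimum of \<open>\<bar>a * t + b\<bar>\<close> is attained in the ball,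
    inside \<open>W\<close>, so it is positive and can serve as \<open>m\<close>.\<close>
  then obtain x where x: "x \<in> cball s r" "\<And>t. t \<in> cball s r \<Longrightarrow> \<bar>a * x + b\<bar> \<le> \<bar>a * t + b\<bar>"
    using continuous_attains_inf[of "cball s r" "\<lambda>t. \<bar>a * t + b\<bar>"] r by auto
  define m where "m = \<bar>a * x + b\<bar>"
  have m: "m > 0" using x w r by (auto simp: m_def)
  define R where "R = 1 + 4 * \<bar>a\<bar> / m + 2 * (\<bar>k\<bar> + a\<^sup>2) / m\<^sup>2"
  have R1: "R \<ge> 1" using m by (simp add: R_def)
  have C0: "C \<ge> 0" using C(1)[of s] r by auto
  \<comment> \<open>The derivatives of \<open>f\<close> are \<open>f\<close> itself followed by
    those of \<open>y\<close>, so indices shift by one; in the bound below, \<open>R \<ge> 1\<close>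
    and growth of the factorial absorb the shift.\<close>
  define Z where "Z = (\<lambda>n. case n of 0 \<Rightarrow> f | Suc j \<Rightarrow> euler_deriv k a b y y1 j)"
  have inW: "t \<in> W" "t \<in> cball s r" if "\<bar>t - s\<bar> < r" for t
    using r that by (auto simp: dist_real_def abs_minus_commute subset_iff)
  have der: "(Z n has_real_derivative Z (Suc n) t) (at t)" if "\<bar>t - s\<bar> < r" for n t
  proof (cases n)
    case 0
    then show ?thesis using f inW[OF that] by (simp add: Z_def)
  next
    case (Suc j)
    then show ?thesis
      using has_derivative_euler_deriv[of y y1 t a b k j] y y1 w inW[OF that] by (simp add: Z_def)
  qed
  have bound: "\<bar>Z n t\<bar> \<le> C * R ^ n * fact n" if "\<bar>t - s\<bar> < r" for n t
  proof (cases n)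
    case 0
    then show ?thesis using C inW[OF that] by (simp add: Z_def)
  next
    case (Suc j)
    have "\<bar>euler_deriv k a b y y1 j t\<bar> \<le> C * R ^ j * fact j"
      by (rule euler_deriv_bound[OF m]) (use C x inW[OF that] in \<open>auto simp: m_def R_def\<close>)
    also have "\<dots> \<le> C * R ^ Suc j * fact (Suc j)"
      using C0 R1 by (intro mult_mono fact_mono power_increasing) auto
    finally show ?thesis by (simp add: Z_def Suc)
  qed
  \<comment> \<open>The radius is cut to \<open>1 / R\<close> to make the geometric remainder
    converge, and to \<open>r\<close> to stay where the bounds hold.\<close>
  have "(\<lambda>n. (t - s) ^ n *\<^sub>R (Z n s / fact n)) sums f t" if "\<bar>t - s\<bar> < min r (1 / R)" for t
  proof -
    have "R * \<bar>t - s\<bar> < 1" using that R1 by (simp add: field_simps)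
    then show ?thesis
      using power_series_of_derivative_bounds[where Z = Z and r = r and s = s and t = t,
          OF der bound] that R1 by (simp add: Z_def)
  qed
  moreover have "min r (1 / R) > 0" using r R1 by simp
  ultimately show "\<exists>a r. r > 0 \<and> (\<forall>t. \<bar>t - s\<bar> < r \<longrightarrow> (\<lambda>n. (t - s) ^ n *\<^sub>R a n) sums f t)"
    by (intro exI[of _ "\<lambda>n. Z n s / fact n"] exI[of _ "min r (1 / R)"]) auto
qed

lemma real_analytic_map_on_euler_ode_vec:
  fixes c :: "real \<Rightarrow> real ^ 'n"
  assumes "open W" and "\<And>s. s \<in> W \<Longrightarrow> a * s + b \<noteq> 0"
    and "\<And>s. s \<in> W \<Longrightarrow> (c has_vector_derivative T s) (at s)"
    and "\<And>s. s \<in> W \<Longrightarrow> (T has_vector_derivative T1 s) (at s)"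
    and "\<And>s. s \<in> W \<Longrightarrow> (T1 has_vector_derivative (k / (a * s + b)\<^sup>2) *\<^sub>R T s) (at s)"
  shows "real_analytic_map_on W c"
proof (rule real_analytic_map_on_componentwise)
  fix i
  have comp: "((\<lambda>s. F s $ i) has_real_derivative F' $ i) (at s)"
    if "(F has_vector_derivative F') (at s)" for F :: "real \<Rightarrow> real ^ 'n" and F' s
    using bounded_linear.has_vector_derivative[OF bounded_linear_vec_nth that]
    by (simp add: has_real_derivative_iff_has_vector_derivative)
  show "real_analytic_map_on W (\<lambda>s. c s $ i)"
    by (rule real_analytic_map_on_euler_ode[OF assms(1,2) comp[OF assms(3)] comp[OF assms(4)]])
       (use comp[OF assms(5)] in auto)
qed

section \<open>Affine curvature\<close>

text \<open>The determinant of the matrix with columns \<open>u\<close> and \<open>v\<close>, that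
  is, the oriented area form of the plane.\<close>

definition cross2 :: "real^2 \<Rightarrow> real^2 \<Rightarrow> real" where
  "cross2 u v = u $ 1 * v $ 2 - u $ 2 * v $ 1"

lemma bounded_bilinear_cross2: "bounded_bilinear cross2"
  unfolding bilinear_conv_bounded_bilinear[symmetric] bilinear_def linear_iff cross2_def
  by (simp add: algebra_simps)

lemmas has_vector_derivative_cross2 =
  bounded_bilinear.has_vector_derivative[OF bounded_bilinear_cross2]

lemma cross2_self [simp]: "cross2 u u = 0"
  by (simp add: cross2_def)

lemma cross2_linear_simps:
  "cross2 (u + v) w = cross2 u w + cross2 v w" "cross2 w (u + v) = cross2 w u + cross2 w v"
  "cross2 (r *\<^sub>R u) v = r * cross2 u v" "cross2 u (r *\<^sub>R v) = r * cross2 u v"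
  by (simp_all add: cross2_def algebra_simps)

lemma cross2_matrix_vector_mult: "cross2 (A *v u) (A *v v) = det A * cross2 u v"
  by (simp add: cross2_def matrix_vector_mult_def det_2 sum_2 algebra_simps)

text \<open>Cramer's rule: the coordinates of \<open>w\<close> with respect to \<open>u\<close> and
  \<open>v\<close>, cleared of the denominator.\<close>

lemma cross2_expansion: "cross2 u v *\<^sub>R w = cross2 w v *\<^sub>R u + cross2 u w *\<^sub>R v"
  by (simp add: vec_eq_iff forall_2 cross2_def algebra_simps)

text \<open>With \<open>u = T\<close> and \<open>v = T'\<close> the left side is the numerator in
  the derivative of the slope \<open>cross2 e T / (T \<bullet> e)\<close>; the right side shows that
  this slope is stationary at inflections.\<close>

lemma cross2_inner_identity:
  "cross2 e v * (u \<bullet> e) - cross2 e u * (v \<bullet> e) = (e \<bullet> e) * cross2 u v"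
  by (simp add: cross2_def inner_vec_def sum_2 algebra_simps)

lemma cross2_eq_0_imp_parallel:
  assumes "cross2 e u = 0" "e \<noteq> 0"
  shows "u = ((u \<bullet> e) / (e \<bullet> e)) *\<^sub>R e"
proof -
  have "(e \<bullet> e) *\<^sub>R u = (u \<bullet> e) *\<^sub>R e"
    using assms(1)
    by (simp add: vec_eq_iff forall_2 cross2_def inner_vec_def sum_2 algebra_simps)
  then have "u = inverse (e \<bullet> e) *\<^sub>R ((u \<bullet> e) *\<^sub>R e)"
    using assms(2) by (metis inner_eq_zero_iff left_inverse scaleR_one scaleR_scaleR)
  then show ?thesis by (simp add: divide_inverse mult.commute)
qed

text \<open>The component of \<open>A *v v\<close> along \<open>u'\<close> drops out and the powers
  \<open>r\<close> and \<open>r^2\<close> multiply. For a transition map this carries inflections to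
  inflections; where \<open>cross2 T T'\<close> is a nonzero constant it gives
  \<open>det A = r ^ 3\<close>.\<close>

lemma cross2_transition:
  assumes "A *v u = r *\<^sub>R u'" "A *v v = q *\<^sub>R u' + r\<^sup>2 *\<^sub>R v'"
  shows "det A * cross2 u v = r ^ 3 * cross2 u' v'"
  unfolding cross2_matrix_vector_mult[symmetric] assms
  by (simp add: cross2_linear_simps power2_eq_square power3_eq_cube)

section \<open>Inflection points and straight pieces\<close>

lemma inflection_everywhere:
  assumes "locally_affine_homogeneous G" "local_param G V c" "s1 \<in> V" "s2 \<in> V"
    and "\<And>s. s \<in> V \<Longrightarrow> (c has_vector_derivative T s) (at s)"
    and "\<And>s. s \<in> V \<Longrightarrow> (T has_vector_derivative T1 s) (at s)"
    and "\<And>s. s \<in> V \<Longrightarrow> T s \<noteq> 0"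
    and "cross2 (T s1) (T1 s1) = 0"
  shows "cross2 (T s2) (T1 s2) = 0"
proof -
  obtain A :: "real^2^2" and e h h1 h2 where "s1 \<in> e" "h s1 = s2" "h1 s1 \<noteq> 0"
    "A *v T s1 = h1 s1 *\<^sub>R T (h s1)"
    "A *v T1 s1 = h2 s1 *\<^sub>R T (h s1) + (h1 s1)\<^sup>2 *\<^sub>R T1 (h s1)"
    using transition_derivatives[OF assms(1-7)] by metis
  then show ?thesis using cross2_transition[of A "T s1" _ "T s2"] assms(8) by fastforce
qed

text \<open>The slope of \<open>T\<close> relative to \<open>e = T t0\<close> has derivative zero,
  so the velocity stays parallel to \<open>e\<close>. With the coordinate along \<open>e\<close> as
  parameter, the velocity becomes the constant \<open>e\<close>.\<close>

lemma analytic_param_of_flat: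
  assumes lp: "local_param G V c" and "t0 \<in> V"
    and c: "\<And>t. t \<in> V \<Longrightarrow> (c has_vector_derivative T t) (at t)"
    and T: "\<And>t. t \<in> V \<Longrightarrow> (T has_vector_derivative T1 t) (at t)"
    and nz: "\<And>t. t \<in> V \<Longrightarrow> T t \<noteq> 0"
    and flat: "\<And>t. t \<in> V \<Longrightarrow> cross2 (T t) (T1 t) = 0"
  obtains W c' where "local_param G W c'" "c t0 \<in> c' ` W" "real_analytic_map_on W c'"
    "\<And>s. s \<in> W \<Longrightarrow> vector_derivative c' (at s) \<noteq> 0"
proof -
  have "open V" using lp by (simp add: local_param_def)
  define e where "e = T t0"
  have e: "e \<noteq> 0" "e \<bullet> e > 0" using nz \<open>t0 \<in> V\<close> by (auto simp: e_def)
  have contT: "continuous_on V T"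
    using T has_vector_derivative_continuous continuous_at_imp_continuous_on by blast
  \<comment> \<open>Near \<open>t0\<close> the component of \<open>T\<close> along \<open>e\<close>
    is positive, so the slope is defined and the coordinate along \<open>e\<close>
    increases.\<close>
  have "open (V \<inter> (\<lambda>t. T t \<bullet> e) -` {0<..})"
    using contT \<open>open V\<close> by (intro continuous_open_preimage continuous_intros) auto
  moreover have "t0 \<in> V \<inter> (\<lambda>t. T t \<bullet> e) -` {0<..}"
    using \<open>t0 \<in> V\<close> e by (simp add: e_def)
  ultimately obtain r where r: "r > 0" "ball t0 r \<subseteq> V \<inter> (\<lambda>t. T t \<bullet> e) -` {0<..}"
    using open_contains_ball by blast
  define I where "I = ball t0 r"
  have pos: "T t \<bullet> e > 0" if "t \<in> I" for t
    using r that unfolding I_def by blast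
  have slope: "((\<lambda>t. T t \<bullet> e) has_real_derivative T1 t \<bullet> e) (at t)"
      "((\<lambda>t. cross2 e (T t)) has_real_derivative cross2 e (T1 t)) (at t)" if "t \<in> V" for t
    using bounded_linear.has_vector_derivative[OF bounded_linear_inner_left T[OF that]]
      bounded_linear.has_vector_derivative[OF
        bounded_bilinear.bounded_linear_right[OF bounded_bilinear_cross2] T[OF that]]
    by (simp_all add: has_real_derivative_iff_has_vector_derivative)
  have m_deriv: "((\<lambda>t. cross2 e (T t) / (T t \<bullet> e)) has_vector_derivative 0) (at t within I)" if "t \<in> I" for t
  proof -
    have "t \<in> V" using that r I_def by blast
    have "((\<lambda>t. cross2 e (T t) / (T t \<bullet> e)) has_real_derivative
        (cross2 e (T1 t) * (T t \<bullet> e) - cross2 e (T t) * (T1 t \<bullet> e)) / ((T t \<bullet> e) * (T t \<bullet> e))) (at t)"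
      by (rule DERIV_divide) (use slope \<open>t \<in> V\<close> pos[OF that] in auto)
    then have "((\<lambda>t. cross2 e (T t) / (T t \<bullet> e)) has_vector_derivative 0) (at t)"
      unfolding cross2_inner_identity flat[OF \<open>t \<in> V\<close>]
      by (simp add: has_real_derivative_iff_has_vector_derivative)
    then show ?thesis by (rule has_vector_derivative_at_within)
  qed
  have "convex I" by (simp add: I_def)
  obtain m where m: "\<And>t. t \<in> I \<Longrightarrow> cross2 e (T t) / (T t \<bullet> e) = m"
    using has_vector_derivative_zero_constant[OF \<open>convex I\<close> m_deriv] by blast
  have "t0 \<in> I" using r by (simp add: I_def)
  \<comment> \<open>At \<open>t0\<close> the velocity is \<open>e\<close> itself, so the constant
    slope is 0.\<close>
  then have "m = 0" using m[of t0] by (simp add: e_def)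
  then have "cross2 e (T t) = 0" if "t \<in> I" for t
    using m[OF that] pos[OF that] by auto
  then have par: "T t = ((T t \<bullet> e) / (e \<bullet> e)) *\<^sub>R e" if "t \<in> I" for t
    using cross2_eq_0_imp_parallel e(1) that by blast
  have f: "((\<lambda>t. (c t \<bullet> e) / (e \<bullet> e)) has_real_derivative (T t \<bullet> e) / (e \<bullet> e)) (at t)"
    if "t \<in> I" for t
  proof -
    have "t \<in> V" using that r I_def by blast
    have "((\<lambda>t. c t \<bullet> e) has_real_derivative T t \<bullet> e) (at t)"
      using bounded_linear.has_vector_derivative[OF bounded_linear_inner_left c[OF \<open>t \<in> V\<close>]]
      by (simp add: has_real_derivative_iff_has_vector_derivative)
    then show ?thesis by (rule DERIV_cdivide)
  qed
  have sub: "I \<subseteq> V" "open I" "connected I" using r by (auto simp: I_def)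
  obtain W g where W: "local_param G W (\<lambda>s. c (g s))" "g ` W = I"
    and g: "\<And>s. s \<in> W \<Longrightarrow> (g has_real_derivative inverse ((T (g s) \<bullet> e) / (e \<bullet> e))) (at s)"
    by (rule local_param_reparam[OF lp sub f]) (use pos e in auto)
  have dcg: "((\<lambda>s. c (g s)) has_vector_derivative e) (at s)" if "s \<in> W" for s
  proof -
    have "g s \<in> I" using W that by blast
    then have "((\<lambda>s. c (g s)) has_vector_derivative
        inverse ((T (g s) \<bullet> e) / (e \<bullet> e)) *\<^sub>R T (g s)) (at s)"
      using vector_diff_chain_at[of g _ s c "T (g s)"] g[OF that] c sub
      by (auto simp: has_real_derivative_iff_has_vector_derivative o_def)
    also have "inverse ((T (g s) \<bullet> e) / (e \<bullet> e)) *\<^sub>R T (g s) = e"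
      using pos[OF \<open>g s \<in> I\<close>] e by (subst (2) par[OF \<open>g s \<in> I\<close>]) simp
    finally show ?thesis .
  qed
  have "open W" using W by (simp add: local_param_def)
  have "real_analytic_map_on W (\<lambda>s. c (g s))"
    \<comment> \<open>A line is a degenerate case of the Euler equation: \<open>a = 0\<close>,
      \<open>b = 1\<close>, \<open>k = 0\<close>, constant velocity \<open>e\<close> and zero
      acceleration.\<close>
    by (rule real_analytic_map_on_euler_ode_vec[of W 0 1 _ "\<lambda>_. e" "\<lambda>_. 0" 0])
       (use \<open>open W\<close> dcg in auto)
  moreover have "c t0 \<in> (\<lambda>s. c (g s)) ` W" using W(2) \<open>t0 \<in> I\<close> by force
  moreover have "vector_derivative (\<lambda>s. c (g s)) (at s) \<noteq> 0" if "s \<in> W" for s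
    using vector_derivative_at[OF dcg[OF that]] e by simp
  ultimately show thesis using that W(1) by blast
qed

text \<open>The scaling law makes \<open>\<kappa>1^2 / \<kappa>^3\<close> constant where
  \<open>\<kappa>\<close> is nonzero, since both powers pick up \<open>l ^ 6\<close>. This says that
  \<open>w\<close>, the power -1/2 of \<open>\<bar>\<kappa>\<bar>\<close>, has constant squared
  derivative; hence \<open>w\<close> is affine and
  \<open>\<bar>\<kappa>\<bar> = 1 / w^2\<close>.\<close>

lemma inverse_square_of_scaling:
  fixes \<kappa> :: "real \<Rightarrow> real"
  assumes "open W" "connected W"
    and \<kappa>: "\<And>s. s \<in> W \<Longrightarrow> (\<kappa> has_real_derivative \<kappa>1 s) (at s)"
    and \<kappa>1: "\<And>s. s \<in> W \<Longrightarrow> (\<kappa>1 has_real_derivative \<kappa>2 s) (at s)"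
    and scaling: "\<And>s t. s \<in> W \<Longrightarrow> t \<in> W \<Longrightarrow>
      \<exists>l. l \<noteq> 0 \<and> \<kappa> s = l\<^sup>2 * \<kappa> t \<and> \<kappa>1 s = l ^ 3 * \<kappa>1 t"
  obtains k a b where "\<And>s. s \<in> W \<Longrightarrow> a * s + b \<noteq> 0" "\<And>s. s \<in> W \<Longrightarrow> \<kappa> s = k / (a * s + b)\<^sup>2"
proof (cases "\<exists>s0\<in>W. \<kappa> s0 \<noteq> 0")
  case False
  then show ?thesis using that[of 0 1 0] by simp
next
  case True
  then obtain s0 where s0: "s0 \<in> W" "\<kappa> s0 \<noteq> 0" by blast
  \<comment> \<open>The law compares \<open>\<kappa>\<close> with \<open>\<kappa> s0\<close> through
    a positive factor, so the sign is constant on \<open>W\<close>: \<open>q\<close> is the absolute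
    value of \<open>\<kappa>\<close>, and \<open>\<epsilon>\<close> becomes the constant
    \<open>k\<close>.\<close>
  define \<epsilon> where "\<epsilon> = sgn (\<kappa> s0)"
  have \<epsilon>: "\<epsilon> \<noteq> 0" "\<epsilon> * \<epsilon> = 1" "\<epsilon> * \<kappa> s0 > 0"
    using s0 by (auto simp: \<epsilon>_def sgn_if)
  define q where "q = (\<lambda>s. \<epsilon> * \<kappa> s)"
  define q1 where "q1 = (\<lambda>s. \<epsilon> * \<kappa>1 s)"
  have q: "(q has_real_derivative q1 s) (at s)" if "s \<in> W" for s
    unfolding q_def q1_def using \<kappa> that by (intro DERIV_cmult)
  have q1: "(q1 has_real_derivative \<epsilon> * \<kappa>2 s) (at s)" if "s \<in> W" for s
    unfolding q1_def using \<kappa>1 that by (intro DERIV_cmult)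
  have qscale: "\<exists>l. l \<noteq> 0 \<and> q s = l\<^sup>2 * q s0 \<and> q1 s = l ^ 3 * q1 s0" if "s \<in> W" for s
    using scaling[OF that s0(1)] by (auto simp: q_def q1_def)
  have pos: "q s > 0" if "s \<in> W" for s
  proof -
    have "q s0 > 0" using \<epsilon> by (simp add: q_def)
    moreover obtain l where "l \<noteq> 0" "q s = l\<^sup>2 * q s0" using qscale[OF \<open>s \<in> W\<close>] by blast
    ultimately show ?thesis by simp
  qed
  define w where "w = (\<lambda>s. q s powr (-1/2))"
  define w1 where "w1 = (\<lambda>s. (-1/2) * (q s powr (-3/2) * q1 s))"
  have w: "(w has_real_derivative w1 s) (at s)" if "s \<in> W" for s
    unfolding w_def w1_def using q[OF that] pos[OF that]
    by (auto intro!: derivative_eq_intros)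
  have w1_sq: "w1 s * w1 s = (q1 s)\<^sup>2 / (4 * (q s) ^ 3)" if "s \<in> W" for s
  proof -
    have "q s powr (-3/2) * q s powr (-3/2) = q s powr (- 3)"
      by (simp flip: powr_add)
    also have "\<dots> = 1 / (q s) ^ 3"
      using pos[OF that] by (simp add: powr_minus powr_numeral divide_inverse)
    finally have "q s powr (-3/2) * q s powr (-3/2) = 1 / (q s) ^ 3" .
    moreover have "w1 s * w1 s = (q s powr (-3/2) * q s powr (-3/2)) * (q1 s)\<^sup>2 / 4"
      by (simp add: w1_def power2_eq_square)
    ultimately show ?thesis by simp
  qed
  have w1_const: "w1 s * w1 s = w1 s0 * w1 s0" if "s \<in> W" for s
  proof -
    obtain l where "l \<noteq> 0" "q s = l\<^sup>2 * q s0" "q1 s = l ^ 3 * q1 s0"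
      using qscale[OF \<open>s \<in> W\<close>] by blast
    then show ?thesis
      using pos[OF s0(1)] unfolding w1_sq[OF that] w1_sq[OF s0(1)]
      by (simp add: power_mult_distrib flip: power_mult)
  qed
  have "\<exists>w2. (w1 has_real_derivative w2) (at s)" if "s \<in> W" for s
    unfolding w1_def using q[OF that] q1[OF that] pos[OF that]
    by (auto intro!: derivative_eq_intros)
  then obtain w2 where w2: "\<And>s. s \<in> W \<Longrightarrow> (w1 has_real_derivative w2 s) (at s)"
    by metis
  have const: "(F has_real_derivative 0) (at s)" if "s \<in> W" "\<And>t. t \<in> W \<Longrightarrow> F t = K" for s F K
    using has_field_derivative_transform_within_open[OF DERIV_const[of K] \<open>open W\<close>] that by metis
  \<comment> \<open>Differentiating \<open>w1 * w1 = const\<close> gives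
    \<open>2 * w1 * w2 = 0\<close>. Either \<open>w1\<close> never vanishes and can be cancelled, or
    it vanishes throughout \<open>W\<close>.\<close>
  have w2_0: "w2 s = 0" if "s \<in> W" for s
  proof (cases "w1 s0 = 0")
    case True
    then have "w1 t = 0" if "t \<in> W" for t using w1_const[OF that] by simp
    then show ?thesis using DERIV_unique[OF w2 const] that by blast
  next
    case False
    then have "w1 s \<noteq> 0" using w1_const[OF that] by auto
    moreover have "w2 s * w1 s + w2 s * w1 s = 0"
      by (rule DERIV_unique[OF DERIV_mult[OF w2 w2] const]) (use that w1_const in auto)
    ultimately show ?thesis by simp
  qed
  have "convex W"
    using \<open>connected W\<close> by (metis is_interval_connected_1 is_interval_convex_1)
  have w1_deriv: "(w1 has_vector_derivative 0) (at s within W)" if "s \<in> W" for s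
    using w2 w2_0 that
    by (metis has_real_derivative_iff_has_vector_derivative has_vector_derivative_at_within)
  obtain a where a: "\<And>s. s \<in> W \<Longrightarrow> w1 s = a"
    using has_vector_derivative_zero_constant[OF \<open>convex W\<close> w1_deriv] by blast
  have w_deriv: "((\<lambda>s. w s - a * s) has_vector_derivative 0) (at s within W)" if "s \<in> W" for s
  proof -
    have "((\<lambda>s. w s - a * s) has_real_derivative 0) (at s)"
      using w[OF that] a[OF that] by (auto intro!: derivative_eq_intros)
    then show ?thesis
      by (simp add: has_real_derivative_iff_has_vector_derivative has_vector_derivative_at_within)
  qed
  obtain b where b: "\<And>s. s \<in> W \<Longrightarrow> w s - a * s = b"
    using has_vector_derivative_zero_constant[OF \<open>convex W\<close> w_deriv] by blast
  have lin: "a * s + b = w s" if "s \<in> W" for s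
    using b[OF that] by simp
  show ?thesis
  proof (rule that)
    fix s assume "s \<in> W"
    then show "a * s + b \<noteq> 0" using pos[of s] lin[of s] by (simp add: w_def)
    have "(w s)\<^sup>2 = q s powr (- 1)"
      unfolding w_def power2_eq_square by (simp flip: powr_add)
    then have "(w s)\<^sup>2 = inverse (q s)"
      using pos[OF \<open>s \<in> W\<close>] by (simp add: powr_minus)
    then have "\<epsilon> / (a * s + b)\<^sup>2 = \<epsilon> * \<epsilon> * \<kappa> s"
      using lin[OF \<open>s \<in> W\<close>] by (simp add: divide_inverse q_def)
    then show "\<kappa> s = \<epsilon> / (a * s + b)\<^sup>2" using \<epsilon>(2) by simp
  qed
qed

text \<open>The hypothesis \<open>unit\<close> fixes the parameter up to affine changes, so
  transition maps have constant derivative \<open>l\<close>. Comparing derivatives of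
  \<open>T\<close> along a transition gives the scaling law required by
  \<open>inverse_square_of_scaling\<close>, and \<open>T'' = \<kappa> T\<close> becomes an Euler
  equation.\<close>

lemma real_analytic_of_affine_arclength:
  assumes hom: "locally_affine_homogeneous G" and lp: "local_param G W c" and "connected W"
    and "smooth_map_on W c"
    and unit: "\<And>s. s \<in> W \<Longrightarrow> cross2 (vderiv c s) (vderiv (vderiv c) s) = \<sigma>" and "\<sigma> \<noteq> 0"
  shows "real_analytic_map_on W c"
proof -
  have "open W" using lp by (simp add: local_param_def)
  define T where "T = vderiv c"
  define T1 where "T1 = vderiv T"
  define T2 where "T2 = vderiv T1"
  define T3 where "T3 = vderiv T2"
  define T4 where "T4 = vderiv T3"
  note D = smooth_map_onD[OF _ \<open>open W\<close>]
  have smT: "smooth_map_on W T" and c: "\<And>s. s \<in> W \<Longrightarrow> (c has_vector_derivative T s) (at s)"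
    using D[OF \<open>smooth_map_on W c\<close>] by (auto simp: T_def)
  have smT1: "smooth_map_on W T1" and T: "\<And>s. s \<in> W \<Longrightarrow> (T has_vector_derivative T1 s) (at s)"
    using D[OF smT] by (auto simp: T1_def)
  have smT2: "smooth_map_on W T2" and T1: "\<And>s. s \<in> W \<Longrightarrow> (T1 has_vector_derivative T2 s) (at s)"
    using D[OF smT1] by (auto simp: T2_def)
  have smT3: "smooth_map_on W T3" and T2: "\<And>s. s \<in> W \<Longrightarrow> (T2 has_vector_derivative T3 s) (at s)"
    using D[OF smT2] by (auto simp: T3_def)
  have T3: "\<And>s. s \<in> W \<Longrightarrow> (T3 has_vector_derivative T4 s) (at s)"
    using D[OF smT3] by (auto simp: T4_def)
  have unit: "cross2 (T s) (T1 s) = \<sigma>" if "s \<in> W" for s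
    using unit[OF that] by (simp add: T_def T1_def)
  have nz: "T s \<noteq> 0" if "s \<in> W" for s
    using unit[OF that] \<open>\<sigma> \<noteq> 0\<close> by (auto simp: cross2_def)
  \<comment> \<open>This is the derivative of the identity \<open>cross2 T T1 = \<sigma>\<close>; it
    makes \<open>T2\<close> parallel to \<open>T\<close>.\<close>
  have TT2: "cross2 (T s) (T2 s) = 0" if "s \<in> W" for s
  proof -
    have "((\<lambda>_. \<sigma>) has_vector_derivative cross2 (T s) (T2 s) + cross2 (T1 s) (T1 s)) (at s)"
      by (rule has_vector_derivative_transform_within_open[OF
            has_vector_derivative_cross2[OF T[OF that] T1[OF that]] \<open>open W\<close> that]) (rule unit)
    from vector_derivative_unique_at[OF this has_vector_derivative_const] show ?thesis by simp
  qed
  \<comment> \<open>The coefficient comes from Cramer's rule in the basis \<open>T\<close>,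
    \<open>T1\<close>. Being a formula in derivatives of \<open>c\<close>, it can be differentiated;
    \<open>\<kappa>1\<close> and \<open>\<kappa>2\<close> keep the raw form of the Leibniz
    rule.\<close>
  define \<kappa> where "\<kappa> = (\<lambda>s. cross2 (T2 s) (T1 s) / \<sigma>)"
  have T2_eq: "T2 s = \<kappa> s *\<^sub>R T s" if "s \<in> W" for s
  proof -
    have "\<sigma> *\<^sub>R T2 s = cross2 (T2 s) (T1 s) *\<^sub>R T s"
      using cross2_expansion[of "T s" "T1 s" "T2 s"] unit[OF that] TT2[OF that] by simp
    then have "inverse \<sigma> *\<^sub>R (\<sigma> *\<^sub>R T2 s) = inverse \<sigma> *\<^sub>R (cross2 (T2 s) (T1 s) *\<^sub>R T s)"
      by simp
    then show ?thesis using \<open>\<sigma> \<noteq> 0\<close> by (simp add: \<kappa>_def divide_inverse mult.commute)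
  qed
  define \<kappa>1 where "\<kappa>1 = (\<lambda>s. (cross2 (T2 s) (T2 s) + cross2 (T3 s) (T1 s)) / \<sigma>)"
  define \<kappa>2 where "\<kappa>2 = (\<lambda>s. (cross2 (T2 s) (T3 s) + cross2 (T3 s) (T2 s)
      + (cross2 (T3 s) (T2 s) + cross2 (T4 s) (T1 s))) / \<sigma>)"
  have \<kappa>: "(\<kappa> has_real_derivative \<kappa>1 s) (at s)" if "s \<in> W" for s
    unfolding \<kappa>_def \<kappa>1_def
    by (intro DERIV_cdivide)
       (use has_vector_derivative_cross2[OF T2 T1] that in
         \<open>simp add: has_real_derivative_iff_has_vector_derivative\<close>)
  have \<kappa>1: "(\<kappa>1 has_real_derivative \<kappa>2 s) (at s)" if "s \<in> W" for s
    unfolding \<kappa>1_def \<kappa>2_def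
    by (intro DERIV_cdivide DERIV_add)
       (use has_vector_derivative_cross2[OF T2 T2] has_vector_derivative_cross2[OF T3 T1] that in
         \<open>simp_all add: has_real_derivative_iff_has_vector_derivative\<close>)
  have scaling: "\<exists>l. l \<noteq> 0 \<and> \<kappa> s1 = l\<^sup>2 * \<kappa> s2 \<and> \<kappa>1 s1 = l ^ 3 * \<kappa>1 s2"
    if st: "s1 \<in> W" "s2 \<in> W" for s1 s2
  proof -
    obtain A :: "real^2^2" and e h h1 h2 where e: "open e" "s1 \<in> e" "e \<subseteq> W"
      and "invertible A" and h: "h s1 = s2" "\<And>s. s \<in> e \<Longrightarrow> h s \<in> W"
      and dh: "\<And>s. s \<in> e \<Longrightarrow> (h has_real_derivative h1 s) (at s)"
      and dh1: "\<And>s. s \<in> e \<Longrightarrow> (h1 has_real_derivative h2 s) (at s)"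
      and AT: "\<And>s. s \<in> e \<Longrightarrow> A *v T s = h1 s *\<^sub>R T (h s)"
      and h1_nz: "\<And>s. s \<in> e \<Longrightarrow> h1 s \<noteq> 0"
      and AT1: "\<And>s. s \<in> e \<Longrightarrow> A *v T1 s = h2 s *\<^sub>R T (h s) + (h1 s)\<^sup>2 *\<^sub>R T1 (h s)"
      by (rule transition_derivatives[OF hom lp st c T nz]) (assumption | rule that)+
    \<comment> \<open>By \<open>cross2_transition\<close> the cube of \<open>h1 s\<close> equals
      \<open>det A\<close>; the real cube root is unique, sign included, so \<open>h1\<close> does
      not depend on \<open>s\<close>.\<close>
    define l where "l = root 3 (det A)"
    have h1: "h1 s = l" if "s \<in> e" for s
    proof -
      have "det A * \<sigma> = h1 s ^ 3 * \<sigma>"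
        using cross2_transition[OF AT AT1] that unit h(2) e(3) by (metis subsetD)
      then have "det A = h1 s ^ 3" using \<open>\<sigma> \<noteq> 0\<close> by simp
      then show ?thesis by (simp add: l_def odd_real_root_power_cancel)
    qed
    then have "l \<noteq> 0" using h1_nz e(2) by metis
    have h2: "h2 s = 0" if "s \<in> e" for s
      using DERIV_unique[OF dh1[OF that]] h1 that
        has_field_derivative_transform_within_open[OF DERIV_const[of l] e(1) that, of h1] by metis
    have comp: "((\<lambda>s. F (h s)) has_vector_derivative l *\<^sub>R F') (at s)"
      if "s \<in> e" "(F has_vector_derivative F') (at (h s))" for F :: "real \<Rightarrow> 'x::real_normed_vector" and F' s
      using vector_diff_chain_at[of h l s F F'] dh[OF that(1)] h1[OF that(1)] that(2)
      by (simp add: has_real_derivative_iff_has_vector_derivative o_def)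
    \<comment> \<open>With \<open>h1 = l\<close> and \<open>h2 = 0\<close> the second-order relation
      reads \<open>A *v T1 s = l^2 *\<^sub>R T1 (h s)\<close>; it is differentiated once
      more.\<close>
    have AT2: "A *v T2 s = l\<^sup>2 *\<^sub>R (l *\<^sub>R T2 (h s))" if "s \<in> e" for s
    proof (rule vector_derivative_unique_at)
      have "s \<in> W" "h s \<in> W" using that e h by auto
      show "((\<lambda>s. A *v T1 s) has_vector_derivative A *v T2 s) (at s)"
        using bounded_linear.has_vector_derivative[OF matrix_vector_mul_bounded_linear T1[OF \<open>s \<in> W\<close>]] .
      have "((\<lambda>s. l\<^sup>2 *\<^sub>R T1 (h s)) has_vector_derivative l\<^sup>2 *\<^sub>R (l *\<^sub>R T2 (h s))) (at s)"
        by (rule bounded_linear.has_vector_derivative[OF bounded_linear_scaleR_right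
              comp[OF that T1[OF \<open>h s \<in> W\<close>]]])
      then show "((\<lambda>s. A *v T1 s) has_vector_derivative l\<^sup>2 *\<^sub>R (l *\<^sub>R T2 (h s))) (at s)"
        by (rule has_vector_derivative_transform_within_open[OF _ e(1) that])
           (simp add: AT1 h1 h2)
    qed
    have \<kappa>_eq: "\<kappa> s = l\<^sup>2 * \<kappa> (h s)" if "s \<in> e" for s
    proof -
      have "s \<in> W" "h s \<in> W" using that e h by auto
      \<comment> \<open>Here \<open>A *v T2 s\<close> is computed twice, from
        \<open>T2 = \<kappa> T\<close> at \<open>s\<close> and from \<open>AT2\<close> with the same
        equation at \<open>h s\<close>.\<close>
      have "\<kappa> s *\<^sub>R (l *\<^sub>R T (h s)) = l\<^sup>2 *\<^sub>R (l *\<^sub>R (\<kappa> (h s) *\<^sub>R T (h s)))"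
        using AT2[OF that] AT[OF that] h1[OF that]
        by (simp add: T2_eq \<open>s \<in> W\<close> \<open>h s \<in> W\<close> matrix_vector_mult_scaleR)
      then have "(\<kappa> s * l) *\<^sub>R T (h s) = (l\<^sup>2 * \<kappa> (h s) * l) *\<^sub>R T (h s)"
        by (simp add: mult_ac)
      then show ?thesis using nz[OF \<open>h s \<in> W\<close>] \<open>l \<noteq> 0\<close> by simp
    qed
    have "\<kappa>1 s1 = l\<^sup>2 * (l * \<kappa>1 s2)"
    proof (rule vector_derivative_unique_at)
      show "(\<kappa> has_vector_derivative \<kappa>1 s1) (at s1)"
        using \<kappa> st by (simp add: has_real_derivative_iff_has_vector_derivative)
      have "((\<lambda>s. \<kappa> (h s)) has_vector_derivative l *\<^sub>R \<kappa>1 s2) (at s1)"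
        using comp[OF e(2), of \<kappa> "\<kappa>1 s2"] \<kappa>[OF st(2)] h(1)
        by (simp add: has_real_derivative_iff_has_vector_derivative)
      then have "((\<lambda>s. l\<^sup>2 * \<kappa> (h s)) has_vector_derivative l\<^sup>2 * (l * \<kappa>1 s2)) (at s1)"
        using bounded_linear.has_vector_derivative[OF bounded_linear_mult_right] by force
      then show "(\<kappa> has_vector_derivative l\<^sup>2 * (l * \<kappa>1 s2)) (at s1)"
        by (rule has_vector_derivative_transform_within_open[OF _ e(1,2)]) (simp add: \<kappa>_eq)
    qed
    then have "\<kappa>1 s1 = l ^ 3 * \<kappa>1 s2" by (simp add: power2_eq_square power3_eq_cube)
    then show ?thesis using \<kappa>_eq[OF e(2)] h(1) \<open>l \<noteq> 0\<close> by blast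
  qed
  obtain k a b where "\<And>s. s \<in> W \<Longrightarrow> a * s + b \<noteq> 0" "\<And>s. s \<in> W \<Longrightarrow> \<kappa> s = k / (a * s + b)\<^sup>2"
    by (rule inverse_square_of_scaling[OF \<open>open W\<close> \<open>connected W\<close> \<kappa> \<kappa>1 scaling])
       (assumption | rule that)+
  then show ?thesis
    by (intro real_analytic_map_on_euler_ode_vec[OF \<open>open W\<close> _ c T]) (use T1 T2_eq in auto)
qed

text \<open>Near \<open>t0\<close> the affine arc length, the integral of the cube root of
  \<open>\<bar>cross2 T T1\<bar>\<close>, is an admissible parameter. It normalises
  \<open>cross2\<close> of velocity and acceleration to the constant
  \<open>\<sigma>\<close>.\<close>

lemma analytic_param_of_curved:
  assumes hom: "locally_affine_homogeneous G" and lp: "local_param G V c" and "t0 \<in> V"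
    and smooth: "smooth_map_on V c"
    and curved: "cross2 (vderiv c t0) (vderiv (vderiv c) t0) \<noteq> 0"
  obtains W c' where "local_param G W c'" "c t0 \<in> c' ` W" "real_analytic_map_on W c'"
    "\<And>s. s \<in> W \<Longrightarrow> vector_derivative c' (at s) \<noteq> 0"
proof -
  have "open V" using lp by (simp add: local_param_def)
  define T where "T = vderiv c"
  define T1 where "T1 = vderiv T"
  note smD = smooth_map_onD[OF _ \<open>open V\<close>]
  have smT: "smooth_map_on V T" and c: "\<And>s. s \<in> V \<Longrightarrow> (c has_vector_derivative T s) (at s)"
    using smD[OF smooth] by (auto simp: T_def)
  have smT1: "smooth_map_on V T1" and T: "\<And>s. s \<in> V \<Longrightarrow> (T has_vector_derivative T1 s) (at s)"
    using smD[OF smT] by (auto simp: T1_def)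
  define \<sigma> where "\<sigma> = sgn (cross2 (T t0) (T1 t0))"
  have \<sigma>: "\<sigma> \<noteq> 0" "\<sigma> * cross2 (T t0) (T1 t0) > 0" "\<sigma> * \<sigma> = 1"
    using curved by (auto simp: \<sigma>_def sgn_if T_def T1_def)
  define E where "E = (\<lambda>t. \<sigma> * cross2 (T t) (T1 t))"
  have C_E: "C_on n V E" for n
    unfolding E_def
    by (intro C_on_mult C_on_const C_on_bilinear[OF bounded_bilinear_cross2])
       (use smT smT1 smooth_map_on_iff_C_on[OF \<open>open V\<close>] in blast)+
  have contE: "continuous_on V E"
    using C_E[of "Suc 0"] has_vector_derivative_continuous continuous_at_imp_continuous_on
    unfolding C_on.simps by blast
  have "open (V \<inter> E -` {0<..})"
    using contE \<open>open V\<close> by (intro continuous_open_preimage) auto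
  moreover have "t0 \<in> V \<inter> E -` {0<..}"
    using \<open>t0 \<in> V\<close> \<sigma> by (simp add: E_def)
  \<comment> \<open>A closed ball is taken so that the integrand is continuous on a compact interval
    and has an antiderivative there; the open ball \<open>I\<close> then gives two-sided
    derivatives.\<close>
  ultimately obtain r where r: "r > 0" "cball t0 r \<subseteq> V \<inter> E -` {0<..}"
    using open_contains_cball by blast
  define I where "I = ball t0 r"
  have I: "I \<subseteq> V" "open I" "connected I" "t0 \<in> I"
    using r ball_subset_cball[of t0 r] by (auto simp: I_def)
  have pos: "E t > 0" if "t \<in> cball t0 r" for t
    using r that by blast
  have posI: "E t > 0" if "t \<in> I" for t
    using pos that by (simp add: I_def)
  \<comment> \<open>Exponent 1/3, because \<open>cross2\<close> of velocity and acceleration scales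
    by the cube of the derivative of the parameter change.\<close>
  define f' where "f' = (\<lambda>t. E t powr (1/3))"
  have "continuous_on {t0 - r..t0 + r} f'"
    unfolding f'_def cball_eq_atLeastAtMost[symmetric]
    by (intro continuous_on_powr continuous_on_const continuous_on_subset[OF contE])
       (use r pos in force)+
  then obtain f where f_within: "\<And>t. t \<in> {t0 - r..t0 + r} \<Longrightarrow>
      (f has_vector_derivative f' t) (at t within {t0 - r..t0 + r})"
    using antiderivative_continuous by blast
  have f: "(f has_real_derivative f' t) (at t)" if "t \<in> I" for t
  proof -
    have "t \<in> interior {t0 - r..t0 + r}"
      using that by (auto simp: I_def dist_real_def)
    then show ?thesis
      using f_within[of t] interior_subset at_within_interior
      by (metis has_real_derivative_iff_has_vector_derivative subsetD)
  qed
  have f'_pos: "f' t > 0" if "t \<in> I" for t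
    using posI[OF that] by (simp add: f'_def)
  obtain W g where W: "local_param G W (\<lambda>s. c (g s))" "g ` W = I" "connected W"
    and g: "\<And>s. s \<in> W \<Longrightarrow> (g has_real_derivative inverse (f' (g s))) (at s)"
    by (rule local_param_reparam[OF lp I(1-3) f f'_pos]) (assumption | rule that)+
  have "open W" using W by (simp add: local_param_def)
  have gI: "g s \<in> I" if "s \<in> W" for s using W(2) that by blast
  \<comment> \<open>Written with \<open>\<rho>\<close>, the inverse \<open>g\<close> solves
    \<open>g' = \<rho>(g)\<close>, so smoothness of \<open>\<rho>\<close> on \<open>I\<close> passes
    to \<open>c(g)\<close>.\<close>
  define \<rho> where "\<rho> = (\<lambda>t. inverse (f' t))"
  have g': "(g has_vector_derivative \<rho> (g s)) (at s)" if "s \<in> W" for s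
    using g[OF that] by (simp add: \<rho>_def has_real_derivative_iff_has_vector_derivative)
  have C_\<rho>: "C_on n I \<rho>" for n
    unfolding \<rho>_def f'_def
    by (intro C_on_inverse C_on_powr C_on_subset[OF C_E I(1)]) (use posI in force)+
  have chain: "((\<lambda>s. F (g s)) has_vector_derivative \<rho> (g s) *\<^sub>R F') (at s)"
    if "s \<in> W" "(F has_vector_derivative F') (at (g s))" for F :: "real \<Rightarrow> real^2" and F' s
    using vector_diff_chain_at[OF g'[OF that(1)] that(2)] by (simp add: o_def)
  have smooth': "smooth_map_on W (\<lambda>s. c (g s))"
    unfolding smooth_map_on_iff_C_on[OF \<open>open W\<close>]
  proof
    fix n
    have "C_on n V c" using smooth smooth_map_on_iff_C_on[OF \<open>open V\<close>] by blast
    then show "C_on n W (\<lambda>s. c (g s))"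
      by (intro C_on_compose_autonomous[OF gI g' C_\<rho>] C_on_subset[OF _ I(1)])
  qed
  define S where "S = vderiv (\<lambda>s. c (g s))"
  have S_eq: "S s = \<rho> (g s) *\<^sub>R T (g s)" if "s \<in> W" for s
    unfolding S_def vderiv_def
    by (rule vector_derivative_at[OF chain[OF that c]]) (use gI that I in blast)
  have unit: "cross2 (S s) (vderiv S s) = \<sigma>" if "s \<in> W" for s
  proof -
    have "g s \<in> I" "g s \<in> V" using gI that I by auto
    obtain \<rho>1 where \<rho>1: "\<forall>t\<in>I. (\<rho> has_vector_derivative \<rho>1 t) (at t)"
      using C_\<rho>[of "Suc 0"] by auto
    have "((\<lambda>t. \<rho> t *\<^sub>R T t) has_vector_derivative
        \<rho> (g s) *\<^sub>R T1 (g s) + \<rho>1 (g s) *\<^sub>R T (g s)) (at (g s))"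
      by (rule bounded_bilinear.has_vector_derivative[OF bounded_bilinear_scaleR])
         (use \<rho>1 T \<open>g s \<in> I\<close> \<open>g s \<in> V\<close> in auto)
    from chain[OF that this]
    have "(S has_vector_derivative
        \<rho> (g s) *\<^sub>R (\<rho> (g s) *\<^sub>R T1 (g s) + \<rho>1 (g s) *\<^sub>R T (g s))) (at s)"
      by (rule has_vector_derivative_transform_within_open[OF _ \<open>open W\<close> that]) (simp add: S_eq)
    then have "vderiv S s = \<rho> (g s) *\<^sub>R (\<rho> (g s) *\<^sub>R T1 (g s) + \<rho>1 (g s) *\<^sub>R T (g s))"
      unfolding vderiv_def by (rule vector_derivative_at)
    \<comment> \<open>The term with \<open>\<rho>1\<close> is parallel to \<open>S s\<close> and
      contributes nothing to \<open>cross2\<close>.\<close>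
    then have "cross2 (S s) (vderiv S s) = \<rho> (g s) ^ 3 * cross2 (T (g s)) (T1 (g s))"
      by (simp add: S_eq[OF that] cross2_linear_simps power3_eq_cube)
    also have "f' (g s) ^ 3 = E (g s)"
      using posI[OF \<open>g s \<in> I\<close>] by (simp add: f'_def powr_powr flip: powr_numeral)
    then have "\<rho> (g s) ^ 3 = inverse (E (g s))"
      by (simp add: \<rho>_def power_inverse)
    also have "cross2 (T (g s)) (T1 (g s)) = \<sigma> * E (g s)"
      using \<sigma>(3) by (simp add: E_def flip: mult.assoc)
    finally show ?thesis using posI[OF \<open>g s \<in> I\<close>] by simp
  qed
  have "real_analytic_map_on W (\<lambda>s. c (g s))"
    by (rule real_analytic_of_affine_arclength[OF hom W(1,3) smooth' unit[unfolded S_def] \<sigma>(1)])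
  moreover have "c t0 \<in> (\<lambda>s. c (g s)) ` W" using W(2) I(4) by force
  moreover have "vector_derivative (\<lambda>s. c (g s)) (at s) \<noteq> 0" if "s \<in> W" for s
    using unit[OF that] \<sigma>(1) by (auto simp: S_def vderiv_def cross2_def)
  ultimately show thesis using that W(1) by blast
qed

section \<open>Exchange of a smooth chart for an analytic one\<close>

theorem theorem1p9:
  fixes \<gamma> :: "(real^2) set"
  assumes "smooth_curve \<gamma>"
    and "locally_affine_homogeneous \<gamma>"
  shows "real_analytic_curve \<gamma>"
  unfolding real_analytic_curve_def embedded_curve_def
proof
  fix p assume "p \<in> \<gamma>"
  then obtain U V c d where U: "open U" "p \<in> U" "open V" "homeomorphism V (\<gamma> \<inter> U) c d"
    and smooth: "smooth_map_on V c" and nz: "\<forall>t\<in>V. vector_derivative c (at t) \<noteq> 0"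
    using assms(1) unfolding smooth_curve_def embedded_curve_def by metis
  then have lp: "local_param \<gamma> V c" by (auto simp: local_param_def)
  obtain t0 where t0: "t0 \<in> V" "c t0 = p"
    using U(2,4) \<open>p \<in> \<gamma>\<close> unfolding homeomorphism_def by (metis IntI imageE)
  note smD = smooth_map_onD[OF _ \<open>open V\<close>]
  have nz': "vderiv c t \<noteq> 0" if "t \<in> V" for t
    using nz that by (simp add: vderiv_def)
  obtain W c' where W: "local_param \<gamma> W c'" "p \<in> c' ` W" "real_analytic_map_on W c'"
    "\<And>s. s \<in> W \<Longrightarrow> vector_derivative c' (at s) \<noteq> 0"
  \<comment> \<open>Testing the single parameter \<open>t0\<close> suffices: an inflection there
    spreads over all of \<open>V\<close> by homogeneity, and otherwise only a neighbourhood of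
    \<open>t0\<close> is reparametrized.\<close>
  proof (cases "cross2 (vderiv c t0) (vderiv (vderiv c) t0) = 0")
    case True
    have "cross2 (vderiv c t) (vderiv (vderiv c) t) = 0" if "t \<in> V" for t
      by (rule inflection_everywhere[OF assms(2) lp t0(1) that smD(2)[OF smooth]
            smD(2)[OF smD(1)[OF smooth]] nz' True])
    from analytic_param_of_flat[OF lp t0(1) smD(2)[OF smooth] smD(2)[OF smD(1)[OF smooth]] nz' this]
    show thesis using that t0(2) by blast
  next
    case False
    from analytic_param_of_curved[OF assms(2) lp t0(1) smooth this]
    show thesis using that t0(2) by blast
  qed
  then obtain U' d' where "open W" "open U'" "homeomorphism W (\<gamma> \<inter> U') c' d'"
    by (auto simp: local_param_def)
  moreover from this have "p \<in> U'"
    using W(2) unfolding homeomorphism_def by blast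
  ultimately show "\<exists>U V c d. open U \<and> p \<in> U \<and> open V \<and> homeomorphism V (\<gamma> \<inter> U) c d \<and>
      real_analytic_map_on V c \<and> (\<forall>t\<in>V. vector_derivative c (at t) \<noteq> 0)"
    using W(3,4) by blast
qed

end
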